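(* Let $G$ be a right multiplier bicomonad on a monoidal category $\mathcal C$. Then the $G$-comodules and their morphisms constitute a monoidal category such that the evident forgetful functor to $\mathcal C$, $(V,\check v)\mapsto V$, is strict monoidal.
   Context: Conventions: $\otimes$ is the monoidal product, $I$ the unit; composition is juxtaposition, $1$ denotes identities, associativity and unit isomorphisms are suppressed. A *right multiplier bicomonad* on $\mathcal C$ is a functor $G:\mathcal C\to\mathcal C$ with natural transformations $\check G_2:GX\otimes GY\to G(GX\otimes Y)$ (natural in $X,Y$) and $\varepsilon:GX\to X$ such that for all objects $X,Y,Z$: - $G(\check G_2\otimes 1)\,\check G_2\,(1\otimes\check G_2)=\check G_2\,(\check G_2\otimes 1)$ as morphisms $GX\otimes GY\otimes GZ\to G(G(GX\otimes Y)\otimes Z)$; - $\varepsilon\,\check G_2=1\otimes\varepsilon: GX\otimes GY\to GX\otimes Y$. A *$G$-comodule* is an object $V$ together with a natural transformation $\check v:V\otimes G(-)\to G(V\otimes -)$ such that for all objects $Y,Z$: - $G(\check v\otimes 1)\,\check v\,(1\otimes\check G_2)=\check G_2\,(\check v\otimes 1)$ as morphisms $V\otimes GY\otimes GZ\to G(G(V\otimes Y)\otimes Z)$; - $\varepsilon\,\check v=1\otimes\varepsilon: V\otimes GY\to V\otimes Y$. A *morphism* of $G$-comodules $(V,\check v)\to(W,\check w)$ is a morphism $f:V\to W$ in $\mathcal C$ such that $G(f\otimes 1)\check v=\check w(f\otimes 1)$. *)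

theory Defs
  imports "HOL-Library.FuncSet"
begin

section \<open>Categories, functors, natural transformations\<close>

text \<open>Arrows carry their domain and codomain. Composition is written in the
  order of function composition.\<close>

record ('o, 'm) cat =
  Obj :: "'o set"
  Arr :: "'m set"
  Dom :: "'m \<Rightarrow> 'o"
  Cod :: "'m \<Rightarrow> 'o"
  Ident :: "'o \<Rightarrow> 'm"  ("\<one>\<index>")
  Comp :: "'m \<Rightarrow> 'm \<Rightarrow> 'm"  (infixl "\<cdot>\<index>" 55)

definition hom :: "('o, 'm, 'x) cat_scheme \<Rightarrow> 'o \<Rightarrow> 'o \<Rightarrow> 'm set" where
  "hom C a b = {f \<in> Arr C. Dom C f = a \<and> Cod C f = b}"

locale category =
  fixes C :: "('o, 'm, 'x) cat_scheme" (structure)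
  assumes Dom_Obj: "f \<in> Arr C \<Longrightarrow> Dom C f \<in> Obj C"
    and Cod_Obj: "f \<in> Arr C \<Longrightarrow> Cod C f \<in> Obj C"
    and Ident_hom: "a \<in> Obj C \<Longrightarrow> \<one> a \<in> hom C a a"
    and Comp_hom: "\<lbrakk>f \<in> hom C a b; g \<in> hom C b c\<rbrakk> \<Longrightarrow> g \<cdot> f \<in> hom C a c"
    and Comp_assoc: "\<lbrakk>f \<in> hom C a b; g \<in> hom C b c; h \<in> hom C c d\<rbrakk>
          \<Longrightarrow> (h \<cdot> g) \<cdot> f = h \<cdot> (g \<cdot> f)"
    and Comp_Ident: "f \<in> hom C a b \<Longrightarrow> f \<cdot> \<one> a = f"
    and Ident_Comp: "f \<in> hom C a b \<Longrightarrow> \<one> b \<cdot> f = f"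

definition inverse_arrows :: "('o, 'm, 'x) cat_scheme \<Rightarrow> 'm \<Rightarrow> 'm \<Rightarrow> bool" where
  "inverse_arrows C f g \<longleftrightarrow>
     f \<in> Arr C \<and> g \<in> hom C (Cod C f) (Dom C f) \<and>
     g \<cdot>\<^bsub>C\<^esub> f = \<one>\<^bsub>C\<^esub> (Dom C f) \<and> f \<cdot>\<^bsub>C\<^esub> g = \<one>\<^bsub>C\<^esub> (Cod C f)"

definition iso_arrow :: "('o, 'm, 'x) cat_scheme \<Rightarrow> 'm \<Rightarrow> bool" where
  "iso_arrow C f \<longleftrightarrow> (\<exists>g. inverse_arrows C f g)"

definition inv_arrow :: "('o, 'm, 'x) cat_scheme \<Rightarrow> 'm \<Rightarrow> 'm" where
  "inv_arrow C f = (THE g. inverse_arrows C f g)"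

definition prod_cat :: "('o, 'm, 'x) cat_scheme \<Rightarrow> ('p, 'n, 'y) cat_scheme
    \<Rightarrow> ('o \<times> 'p, 'm \<times> 'n) cat" where
  "prod_cat C D =
     \<lparr>Obj = Obj C \<times> Obj D, Arr = Arr C \<times> Arr D,
      Dom = (\<lambda>(f, g). (Dom C f, Dom D g)), Cod = (\<lambda>(f, g). (Cod C f, Cod D g)),
      Ident = (\<lambda>(a, b). (\<one>\<^bsub>C\<^esub> a, \<one>\<^bsub>D\<^esub> b)),
      Comp = (\<lambda>(f', g') (f, g). (f' \<cdot>\<^bsub>C\<^esub> f, g' \<cdot>\<^bsub>D\<^esub> g))\<rparr>"

record ('o, 'm, 'p, 'n) ftr =
  ob :: "'o \<Rightarrow> 'p"  (infixr "$\<^sub>o" 100)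
  ar :: "'m \<Rightarrow> 'n"  (infixr "$\<^sub>m" 100)

definition id_ftr :: "('o, 'm, 'o, 'm) ftr" where
  "id_ftr = \<lparr>ob = \<lambda>a. a, ar = \<lambda>f. f\<rparr>"

locale cat_functor = C: category C + D: category D
  for C :: "('o, 'm, 'x) cat_scheme" and D :: "('p, 'n, 'y) cat_scheme" +
  fixes F :: "('o, 'm, 'p, 'n) ftr"
  assumes ob_Obj: "a \<in> Obj C \<Longrightarrow> F $\<^sub>o a \<in> Obj D"
    and ar_hom: "f \<in> hom C a b \<Longrightarrow> F $\<^sub>m f \<in> hom D (F $\<^sub>o a) (F $\<^sub>o b)"
    and ar_Ident: "a \<in> Obj C \<Longrightarrow> F $\<^sub>m \<one>\<^bsub>C\<^esub> a = \<one>\<^bsub>D\<^esub> (F $\<^sub>o a)"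
    and ar_Comp: "\<lbrakk>f \<in> hom C a b; g \<in> hom C b c\<rbrakk>
          \<Longrightarrow> F $\<^sub>m (g \<cdot>\<^bsub>C\<^esub> f) = F $\<^sub>m g \<cdot>\<^bsub>D\<^esub> F $\<^sub>m f"

locale nat_trans = F: cat_functor C D F + G: cat_functor C D G
  for C :: "('o, 'm, 'x) cat_scheme" and D :: "('p, 'n, 'y) cat_scheme"
    and F G :: "('o, 'm, 'p, 'n) ftr" +
  fixes t :: "'o \<Rightarrow> 'n"
  assumes component: "a \<in> Obj C \<Longrightarrow> t a \<in> hom D (F $\<^sub>o a) (G $\<^sub>o a)"
    and naturality: "f \<in> hom C a b \<Longrightarrow> t b \<cdot>\<^bsub>D\<^esub> F $\<^sub>m f = G $\<^sub>m f \<cdot>\<^bsub>D\<^esub> t a"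

locale nat_iso = nat_trans +
  assumes component_iso: "a \<in> Obj C \<Longrightarrow> iso_arrow D (t a)"


section \<open>Monoidal categories\<close>

text \<open>The associator is oriented as \<open>(a \<otimes> b) \<otimes> c \<rightarrow> a \<otimes> (b \<otimes> c)\<close>, the unitors as
  \<open>I \<otimes> a \<rightarrow> a\<close> and \<open>a \<otimes> I \<rightarrow> a\<close>.\<close>

record ('o, 'm) moncat = "('o, 'm) cat" +
  Tensor_ob :: "'o \<Rightarrow> 'o \<Rightarrow> 'o"  (infixr "\<otimes>\<index>" 70)
  Tensor_ar :: "'m \<Rightarrow> 'm \<Rightarrow> 'm"  (infixr "\<otimes>\<^sub>m\<index>" 70)
  Unit :: "'o"  ("\<I>\<index>")
  Assoc :: "'o \<Rightarrow> 'o \<Rightarrow> 'o \<Rightarrow> 'm"  ("\<alpha>\<index>")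
  LUnit :: "'o \<Rightarrow> 'm"  ("\<l>\<index>")
  RUnit :: "'o \<Rightarrow> 'm"  ("\<r>\<index>")

locale monoidal_category = category C
  for C :: "('o, 'm, 'x) moncat_scheme" (structure) +
  assumes tensor_functor:
      "cat_functor (prod_cat C C) C
         \<lparr>ob = \<lambda>(a, b). a \<otimes> b, ar = \<lambda>(f, g). f \<otimes>\<^sub>m g\<rparr>"
    and Unit_Obj: "\<I> \<in> Obj C"
    and Assoc_iso:
      "nat_iso (prod_cat (prod_cat C C) C) C
         \<lparr>ob = \<lambda>((a, b), c). (a \<otimes> b) \<otimes> c, ar = \<lambda>((f, g), h). (f \<otimes>\<^sub>m g) \<otimes>\<^sub>m h\<rparr>
         \<lparr>ob = \<lambda>((a, b), c). a \<otimes> (b \<otimes> c), ar = \<lambda>((f, g), h). f \<otimes>\<^sub>m (g \<otimes>\<^sub>m h)\<rparr>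
         (\<lambda>((a, b), c). \<alpha> a b c)"
    and LUnit_iso: "nat_iso C C \<lparr>ob = \<lambda>a. \<I> \<otimes> a, ar = \<lambda>f. \<one> \<I> \<otimes>\<^sub>m f\<rparr> id_ftr (\<lambda>a. \<l> a)"
    and RUnit_iso: "nat_iso C C \<lparr>ob = \<lambda>a. a \<otimes> \<I>, ar = \<lambda>f. f \<otimes>\<^sub>m \<one> \<I>\<rparr> id_ftr (\<lambda>a. \<r> a)"
    and pentagon:
      "\<lbrakk>a \<in> Obj C; b \<in> Obj C; c \<in> Obj C; d \<in> Obj C\<rbrakk> \<Longrightarrow>
         \<alpha> a b (c \<otimes> d) \<cdot> \<alpha> (a \<otimes> b) c d
         = (\<one> a \<otimes>\<^sub>m \<alpha> b c d) \<cdot> \<alpha> a (b \<otimes> c) d \<cdot> (\<alpha> a b c \<otimes>\<^sub>m \<one> d)"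
    and triangle:
      "\<lbrakk>a \<in> Obj C; b \<in> Obj C\<rbrakk> \<Longrightarrow> (\<one> a \<otimes>\<^sub>m \<l> b) \<cdot> \<alpha> a \<I> b = \<r> a \<otimes>\<^sub>m \<one> b"

locale strict_monoidal_functor =
  C: monoidal_category C + D: monoidal_category D + cat_functor C D F
  for C :: "('o, 'm, 'x) moncat_scheme" and D :: "('p, 'n, 'y) moncat_scheme"
    and F :: "('o, 'm, 'p, 'n) ftr" +
  assumes Tensor_ob: "\<lbrakk>a \<in> Obj C; b \<in> Obj C\<rbrakk>
            \<Longrightarrow> F $\<^sub>o (a \<otimes>\<^bsub>C\<^esub> b) = F $\<^sub>o a \<otimes>\<^bsub>D\<^esub> F $\<^sub>o b"
    and Tensor_ar: "\<lbrakk>f \<in> Arr C; g \<in> Arr C\<rbrakk>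
            \<Longrightarrow> F $\<^sub>m (f \<otimes>\<^sub>m\<^bsub>C\<^esub> g) = F $\<^sub>m f \<otimes>\<^sub>m\<^bsub>D\<^esub> F $\<^sub>m g"
    and Unit: "F $\<^sub>o \<I>\<^bsub>C\<^esub> = \<I>\<^bsub>D\<^esub>"
    and Assoc: "\<lbrakk>a \<in> Obj C; b \<in> Obj C; c \<in> Obj C\<rbrakk>
            \<Longrightarrow> F $\<^sub>m (\<alpha>\<^bsub>C\<^esub> a b c) = \<alpha>\<^bsub>D\<^esub> (F $\<^sub>o a) (F $\<^sub>o b) (F $\<^sub>o c)"
    and LUnit: "a \<in> Obj C \<Longrightarrow> F $\<^sub>m (\<l>\<^bsub>C\<^esub> a) = \<l>\<^bsub>D\<^esub> (F $\<^sub>o a)"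
    and RUnit: "a \<in> Obj C \<Longrightarrow> F $\<^sub>m (\<r>\<^bsub>C\<^esub> a) = \<r>\<^bsub>D\<^esub> (F $\<^sub>o a)"


section \<open>Right multiplier bicomonads and their comodules\<close>

text \<open>The base category need not be strict, so the associators that are usually suppressed
  are written out: both sides of \<open>G2_coassoc\<close> start at \<open>(GX \<otimes> GY) \<otimes> GZ\<close> and end at
  \<open>G (G (GX \<otimes> Y) \<otimes> Z)\<close>.\<close>

locale right_multiplier_bicomonad = monoidal_category C
  for C :: "('o, 'm, 'x) moncat_scheme" (structure) +
  fixes G :: "('o, 'm, 'o, 'm) ftr"
    and G2 :: "'o \<Rightarrow> 'o \<Rightarrow> 'm"
    and \<epsilon> :: "'o \<Rightarrow> 'm"
  assumes G_functor: "cat_functor C C G"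
    and G2_natural:
      "nat_trans (prod_cat C C) C
         \<lparr>ob = \<lambda>(X, Y). G $\<^sub>o X \<otimes> G $\<^sub>o Y, ar = \<lambda>(f, g). G $\<^sub>m f \<otimes>\<^sub>m G $\<^sub>m g\<rparr>
         \<lparr>ob = \<lambda>(X, Y). G $\<^sub>o (G $\<^sub>o X \<otimes> Y), ar = \<lambda>(f, g). G $\<^sub>m (G $\<^sub>m f \<otimes>\<^sub>m g)\<rparr>
         (\<lambda>(X, Y). G2 X Y)"
    and counit_natural: "nat_trans C C G id_ftr \<epsilon>"
    and G2_coassoc:
      "\<lbrakk>X \<in> Obj C; Y \<in> Obj C; Z \<in> Obj C\<rbrakk> \<Longrightarrow>
         G $\<^sub>m (G2 X Y \<otimes>\<^sub>m \<one> Z)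
           \<cdot> G $\<^sub>m (inv_arrow C (\<alpha> (G $\<^sub>o X) (G $\<^sub>o Y) Z))
           \<cdot> G2 X (G $\<^sub>o Y \<otimes> Z)
           \<cdot> (\<one> (G $\<^sub>o X) \<otimes>\<^sub>m G2 Y Z)
           \<cdot> \<alpha> (G $\<^sub>o X) (G $\<^sub>o Y) (G $\<^sub>o Z)
         = G2 (G $\<^sub>o X \<otimes> Y) Z \<cdot> (G2 X Y \<otimes>\<^sub>m \<one> (G $\<^sub>o Z))"
    and G2_counit:
      "\<lbrakk>X \<in> Obj C; Y \<in> Obj C\<rbrakk> \<Longrightarrow>
         \<epsilon> (G $\<^sub>o X \<otimes> Y) \<cdot> G2 X Y = \<one> (G $\<^sub>o X) \<otimes>\<^sub>m \<epsilon> Y"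

text \<open>The component of the coaction \<open>v\<close> at \<open>Y\<close> is an arrow \<open>V \<otimes> GY \<rightarrow> G (V \<otimes> Y)\<close>.
  As a family indexed by the objects of \<open>C\<close>, \<open>v\<close> is \<^term>\<open>undefined\<close> elsewhere, so that two
  comodules are equal exactly when they have the same object and the same components.\<close>

locale comodule = right_multiplier_bicomonad C G G2 \<epsilon>
  for C :: "('o, 'm, 'x) moncat_scheme" (structure) and G G2 \<epsilon> +
  fixes V :: 'o and v :: "'o \<Rightarrow> 'm"
  assumes V_Obj: "V \<in> Obj C"
    and v_extensional: "v \<in> extensional (Obj C)"
    and v_natural:
      "nat_trans C C
         \<lparr>ob = \<lambda>Y. V \<otimes> G $\<^sub>o Y, ar = \<lambda>g. \<one> V \<otimes>\<^sub>m G $\<^sub>m g\<rparr>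
         \<lparr>ob = \<lambda>Y. G $\<^sub>o (V \<otimes> Y), ar = \<lambda>g. G $\<^sub>m (\<one> V \<otimes>\<^sub>m g)\<rparr>
         v"
    and v_coassoc:
      "\<lbrakk>Y \<in> Obj C; Z \<in> Obj C\<rbrakk> \<Longrightarrow>
         G $\<^sub>m (v Y \<otimes>\<^sub>m \<one> Z)
           \<cdot> G $\<^sub>m (inv_arrow C (\<alpha> V (G $\<^sub>o Y) Z))
           \<cdot> v (G $\<^sub>o Y \<otimes> Z)
           \<cdot> (\<one> V \<otimes>\<^sub>m G2 Y Z)
           \<cdot> \<alpha> V (G $\<^sub>o Y) (G $\<^sub>o Z)
         = G2 (V \<otimes> Y) Z \<cdot> (v Y \<otimes>\<^sub>m \<one> (G $\<^sub>o Z))"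
    and v_counit: "Y \<in> Obj C \<Longrightarrow> \<epsilon> (V \<otimes> Y) \<cdot> v Y = \<one> V \<otimes>\<^sub>m \<epsilon> Y"

locale comodule_morphism =
  V: comodule C G G2 \<epsilon> V v + W: comodule C G G2 \<epsilon> W w
  for C :: "('o, 'm, 'x) moncat_scheme" (structure) and G G2 \<epsilon> V v W w +
  fixes f :: 'm
  assumes f_hom: "f \<in> hom C V W"
    and f_coaction: "Y \<in> Obj C \<Longrightarrow> G $\<^sub>m (f \<otimes>\<^sub>m \<one> Y) \<cdot> v Y = w Y \<cdot> (f \<otimes>\<^sub>m \<one> (G $\<^sub>o Y))"

text \<open>An arrow of the category of comodules is a morphism of comodules together with its source
  and its target, which the underlying arrow of \<open>C\<close> does not determine.\<close>

type_synonym ('o, 'm) comod = "'o \<times> ('o \<Rightarrow> 'm)"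
type_synonym ('o, 'm) comod_arr = "('o, 'm) comod \<times> 'm \<times> ('o, 'm) comod"

definition comodule_category :: "('o, 'm, 'x) moncat_scheme \<Rightarrow> ('o, 'm, 'o, 'm) ftr
    \<Rightarrow> ('o \<Rightarrow> 'o \<Rightarrow> 'm) \<Rightarrow> ('o \<Rightarrow> 'm) \<Rightarrow> (('o, 'm) comod, ('o, 'm) comod_arr) cat" where
  "comodule_category C G G2 \<epsilon> =
     \<lparr>Obj = {(V, v). comodule C G G2 \<epsilon> V v},
      Arr = {((V, v), f, (W, w)). comodule_morphism C G G2 \<epsilon> V v W w f},
      Dom = (\<lambda>(p, f, q). p),
      Cod = (\<lambda>(p, f, q). q),
      Ident = (\<lambda>(V, v). ((V, v), \<one>\<^bsub>C\<^esub> V, (V, v))),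
      Comp = (\<lambda>(q', g, r) (p, f, q). (p, g \<cdot>\<^bsub>C\<^esub> f, r))\<rparr>"

definition forgetful :: "(('o, 'm) comod, ('o, 'm) comod_arr, 'o, 'm) ftr" where
  "forgetful = \<lparr>ob = \<lambda>(V, v). V, ar = \<lambda>(p, f, q). f\<rparr>"

end

theory Submission
  imports Defs
begin

text \<open>Forget for a moment the axioms of a comodule and call a \<^emph>\<open>precomodule\<close> an object \<open>V\<close> with any
  natural transformation \<open>v\<close> from \<open>V \<otimes> G(-)\<close> to \<open>G(V \<otimes> -)\<close>; morphisms are arrows of \<open>C\<close> that
  commute with these transformations. For every endofunctor \<open>G\<close> of a monoidal category, precomodules form
  a monoidal category: the transformation of \<open>V \<otimes> W\<close> moves \<open>G\<close> out past \<open>W\<close> and then past \<open>V\<close>.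
  That the associator and the unitors are morphisms is pure coherence (lemmas \<open>precomodule_morphism_assoc\<close>,
  \<open>precomodule_morphism_lunit\<close>, \<open>precomodule_morphism_runit\<close>).

  Now let \<open>G\<close> be a right multiplier bicomonad. Each \<open>GX\<close> is a precomodule under \<open>G2 X\<close>, and by naturality
  each \<open>Gf\<close> is a morphism of precomodules. The point of the proof is lemma
  \<open>coassoc_iff_precomodule_morphism\<close>: coassociativity of \<open>v\<close> says precisely that each component
  \<open>v Y : V \<otimes> GY \<rightarrow> G(V \<otimes> Y)\<close> is a morphism of precomodules. Hence the coaction of a tensor product,
  being composed of an associator, components of the two given coactions and a value of \<open>G\<close>, is again
  coassociative because morphisms compose and tensor; likewise for the unit object, where only a
  unitor and a value of \<open>G\<close> occur. The counit axiom follows from naturality of \<open>\<epsilon>\<close>. So the comodules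
  are a full subcategory of the precomodules that contains the unit and is closed under tensor products.
  The constraints are those of \<open>C\<close>, so their equations hold because they hold in \<open>C\<close>, and the
  forgetful functor preserves all structure on the nose.\<close>

section \<open>Calculating with arrows\<close>

text \<open>Membership in hom-sets is traded for equations about domains and codomains: these have no
  variables beyond those of the composite, so that rewriting can discharge every typing condition.\<close>

context category
begin

lemma in_hom_iff: "f \<in> hom C a b \<longleftrightarrow> f \<in> Arr C \<and> Dom C f = a \<and> Cod C f = b"
  by (auto simp: hom_def)

lemma Ident_simps [simp]:
  assumes "a \<in> Obj C"
  shows "\<one> a \<in> Arr C" "Dom C (\<one> a) = a" "Cod C (\<one> a) = a"
  using Ident_hom[OF assms] by (auto simp: in_hom_iff)

lemma comp_simps [simp]:
  assumes "f \<in> Arr C" "g \<in> Arr C" "Dom C g = Cod C f"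
  shows "g \<cdot> f \<in> Arr C" "Dom C (g \<cdot> f) = Dom C f" "Cod C (g \<cdot> f) = Cod C g"
  using Comp_hom[of f "Dom C f" "Cod C f" g "Cod C g"] assms by (auto simp: in_hom_iff)

lemma comp_assoc:
  assumes "f \<in> Arr C" "g \<in> Arr C" "h \<in> Arr C" "Dom C g = Cod C f" "Dom C h = Cod C g"
  shows "(h \<cdot> g) \<cdot> f = h \<cdot> (g \<cdot> f)"
  by (rule Comp_assoc) (use assms in \<open>auto simp: in_hom_iff\<close>)

lemma comp_ident_right [simp]: "\<lbrakk>f \<in> Arr C; Dom C f = a\<rbrakk> \<Longrightarrow> f \<cdot> \<one> a = f"
  by (rule Comp_Ident) (auto simp: in_hom_iff)

lemma comp_ident_left [simp]: "\<lbrakk>f \<in> Arr C; Cod C f = a\<rbrakk> \<Longrightarrow> \<one> a \<cdot> f = f"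
  by (rule Ident_Comp) (auto simp: in_hom_iff)

lemma Dom_Cod_Obj [simp]: "f \<in> Arr C \<Longrightarrow> Dom C f \<in> Obj C" "f \<in> Arr C \<Longrightarrow> Cod C f \<in> Obj C"
  by (auto intro: Dom_Obj Cod_Obj)

text \<open>Composites are kept bracketed to the right; this turns an equation between composites into a
  rule that also applies in front of a further arrow.\<close>

lemma comp_extend:
  assumes "g \<cdot> f = k" "f \<in> Arr C" "g \<in> Arr C" "x \<in> Arr C" "Dom C g = Cod C f" "Dom C f = Cod C x"
  shows "g \<cdot> (f \<cdot> x) = k \<cdot> x"
  using assms by (metis comp_assoc)

lemma inverse_arrows_unique:
  assumes "inverse_arrows C f g" "inverse_arrows C f h"
  shows "g = h"
proof -
  have "g = g \<cdot> (f \<cdot> h)" using assms by (simp add: inverse_arrows_def in_hom_iff)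
  also have "\<dots> = (g \<cdot> f) \<cdot> h"
    using assms by (subst comp_assoc) (auto simp: inverse_arrows_def in_hom_iff)
  also have "\<dots> = h" using assms by (simp add: inverse_arrows_def in_hom_iff)
  finally show ?thesis .
qed

lemma inv_arrow_eq: "inverse_arrows C f g \<Longrightarrow> inv_arrow C f = g"
  unfolding inv_arrow_def by (blast intro: inverse_arrows_unique)

lemma inverse_arrows_inv: "iso_arrow C f \<Longrightarrow> inverse_arrows C f (inv_arrow C f)"
  unfolding iso_arrow_def using inv_arrow_eq by blast

lemma iso_arrow_Arr: "iso_arrow C f \<Longrightarrow> f \<in> Arr C"
  unfolding iso_arrow_def inverse_arrows_def by blast

lemma inv_simps [simp]:
  assumes "iso_arrow C f"
  shows "inv_arrow C f \<in> Arr C" "Dom C (inv_arrow C f) = Cod C f"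
    "Cod C (inv_arrow C f) = Dom C f"
    "inv_arrow C f \<cdot> f = \<one> (Dom C f)" "f \<cdot> inv_arrow C f = \<one> (Cod C f)"
  using inverse_arrows_inv[OF assms] by (auto simp: inverse_arrows_def in_hom_iff)

lemma inv_cancel [simp]:
  assumes "iso_arrow C f" "x \<in> Arr C"
  shows "Dom C f = Cod C x \<Longrightarrow> inv_arrow C f \<cdot> (f \<cdot> x) = x"
    "Cod C f = Cod C x \<Longrightarrow> f \<cdot> (inv_arrow C f \<cdot> x) = x"
  using assms iso_arrow_Arr[OF assms(1)] by (simp_all flip: comp_assoc)

lemma inv_left_eq_iff:
  assumes "iso_arrow C f" "x \<in> Arr C" "y \<in> Arr C" "Cod C f = Cod C x" "Cod C y = Dom C f"
  shows "inv_arrow C f \<cdot> x = y \<longleftrightarrow> x = f \<cdot> y"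
  using assms by auto

lemma iso_epi:
  assumes "iso_arrow C f" "x \<in> Arr C" "y \<in> Arr C" "Dom C x = Cod C f" "Dom C y = Cod C f"
    and "x \<cdot> f = y \<cdot> f"
  shows "x = y"
proof -
  have "(x \<cdot> f) \<cdot> inv_arrow C f = (y \<cdot> f) \<cdot> inv_arrow C f"
    by (simp only: assms(6))
  moreover have "(z \<cdot> f) \<cdot> inv_arrow C f = z" if "z \<in> Arr C" "Dom C z = Cod C f" for z
    using that assms(1) iso_arrow_Arr[OF assms(1)] by (simp add: comp_assoc)
  ultimately show ?thesis using assms(2-5) by metis
qed

lemma ident_iso [simp]: "a \<in> Obj C \<Longrightarrow> iso_arrow C (\<one> a)"
  unfolding iso_arrow_def by (rule exI[of _ "\<one> a"]) (simp add: inverse_arrows_def in_hom_iff)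

end

lemma hom_prod [simp]:
  "(f, g) \<in> hom (prod_cat C D) p q \<longleftrightarrow> f \<in> hom C (fst p) (fst q) \<and> g \<in> hom D (snd p) (snd q)"
  by (cases p; cases q) (auto simp: hom_def prod_cat_def)

lemma prod_cat_simps [simp]:
  "Obj (prod_cat C D) = Obj C \<times> Obj D"
  "Arr (prod_cat C D) = Arr C \<times> Arr D"
  "\<one>\<^bsub>prod_cat C D\<^esub> (a, b) = (\<one>\<^bsub>C\<^esub> a, \<one>\<^bsub>D\<^esub> b)"
  "(f', g') \<cdot>\<^bsub>prod_cat C D\<^esub> (f, g) = (f' \<cdot>\<^bsub>C\<^esub> f, g' \<cdot>\<^bsub>D\<^esub> g)"
  by (auto simp: prod_cat_def)

lemma category_prod:
  assumes "category C" "category D"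
  shows "category (prod_cat C D)"
proof -
  interpret C: category C by fact
  interpret D: category D by fact
  show ?thesis
  proof
    fix f g h a b c d
    assume "f \<in> hom (prod_cat C D) a b" "g \<in> hom (prod_cat C D) b c" "h \<in> hom (prod_cat C D) c d"
    then show "(h \<cdot>\<^bsub>prod_cat C D\<^esub> g) \<cdot>\<^bsub>prod_cat C D\<^esub> f = h \<cdot>\<^bsub>prod_cat C D\<^esub> (g \<cdot>\<^bsub>prod_cat C D\<^esub> f)"
      by (cases f; cases g; cases h)
        (auto simp: prod_cat_def hom_def C.comp_assoc D.comp_assoc)
  qed (auto simp: prod_cat_def hom_def split_beta)
qed

section \<open>Coherence in monoidal categories\<close>

context monoidal_category
begin

lemma tensor_Obj [simp]: "\<lbrakk>a \<in> Obj C; b \<in> Obj C\<rbrakk> \<Longrightarrow> a \<otimes> b \<in> Obj C"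
  using cat_functor.ob_Obj[OF tensor_functor, of "(a, b)"] by (simp add: prod_cat_def)

lemma tensor_simps [simp]:
  assumes "f \<in> Arr C" "g \<in> Arr C"
  shows "f \<otimes>\<^sub>m g \<in> Arr C" "Dom C (f \<otimes>\<^sub>m g) = Dom C f \<otimes> Dom C g"
    "Cod C (f \<otimes>\<^sub>m g) = Cod C f \<otimes> Cod C g"
  using cat_functor.ar_hom[OF tensor_functor, of "(f, g)" "(Dom C f, Dom C g)" "(Cod C f, Cod C g)"]
    assms by (auto simp: prod_cat_def hom_def)

lemma tensor_ident [simp]: "\<lbrakk>a \<in> Obj C; b \<in> Obj C\<rbrakk> \<Longrightarrow> \<one> a \<otimes>\<^sub>m \<one> b = \<one> (a \<otimes> b)"
  using cat_functor.ar_Ident[OF tensor_functor, of "(a, b)"] by (simp add: prod_cat_def)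

lemma tensor_comp:
  assumes "f \<in> Arr C" "g \<in> Arr C" "f' \<in> Arr C" "g' \<in> Arr C"
    "Dom C f' = Cod C f" "Dom C g' = Cod C g"
  shows "(f' \<otimes>\<^sub>m g') \<cdot> (f \<otimes>\<^sub>m g) = (f' \<cdot> f) \<otimes>\<^sub>m (g' \<cdot> g)"
  using cat_functor.ar_Comp[OF tensor_functor, of "(f, g)" "(Dom C f, Dom C g)" "(Cod C f, Cod C g)"
      "(f', g')" "(Cod C f', Cod C g')"] assms
  by (simp add: prod_cat_def hom_def)

lemma tensor_comp_extend:
  assumes "f \<in> Arr C" "g \<in> Arr C" "f' \<in> Arr C" "g' \<in> Arr C"
    "Dom C f' = Cod C f" "Dom C g' = Cod C g" "x \<in> Arr C" "Dom C f \<otimes> Dom C g = Cod C x"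
  shows "(f' \<otimes>\<^sub>m g') \<cdot> ((f \<otimes>\<^sub>m g) \<cdot> x) = ((f' \<cdot> f) \<otimes>\<^sub>m (g' \<cdot> g)) \<cdot> x"
  by (rule comp_extend[OF tensor_comp]) (use assms in auto)

lemma Unit_Obj' [simp]: "\<I> \<in> Obj C" by (rule Unit_Obj)

lemma assoc_iso [simp]: "\<lbrakk>a \<in> Obj C; b \<in> Obj C; c \<in> Obj C\<rbrakk> \<Longrightarrow> iso_arrow C (\<alpha> a b c)"
  using nat_iso.component_iso[OF Assoc_iso, of "((a, b), c)"] by (simp add: prod_cat_def)

lemma assoc_simps [simp]:
  assumes "a \<in> Obj C" "b \<in> Obj C" "c \<in> Obj C"
  shows "\<alpha> a b c \<in> Arr C" "Dom C (\<alpha> a b c) = (a \<otimes> b) \<otimes> c" "Cod C (\<alpha> a b c) = a \<otimes> (b \<otimes> c)"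
  using nat_trans.component[OF nat_iso.axioms(1)[OF Assoc_iso], of "((a, b), c)"] assms
  by (auto simp: prod_cat_def hom_def)

lemma assoc_natural:
  assumes "f \<in> Arr C" "g \<in> Arr C" "h \<in> Arr C" "Cod C f = a" "Cod C g = b" "Cod C h = c"
  shows "\<alpha> a b c \<cdot> ((f \<otimes>\<^sub>m g) \<otimes>\<^sub>m h) = (f \<otimes>\<^sub>m (g \<otimes>\<^sub>m h)) \<cdot> \<alpha> (Dom C f) (Dom C g) (Dom C h)"
  using nat_trans.naturality[OF nat_iso.axioms(1)[OF Assoc_iso], of "((f, g), h)"
      "((Dom C f, Dom C g), Dom C h)" "((Cod C f, Cod C g), Cod C h)"] assms
  by (simp add: prod_cat_def hom_def)

lemma lunit_iso [simp]: "a \<in> Obj C \<Longrightarrow> iso_arrow C (\<l> a)"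
  by (rule nat_iso.component_iso[OF LUnit_iso])

lemma runit_iso [simp]: "a \<in> Obj C \<Longrightarrow> iso_arrow C (\<r> a)"
  by (rule nat_iso.component_iso[OF RUnit_iso])

lemma lunit_simps [simp]:
  assumes "a \<in> Obj C"
  shows "\<l> a \<in> Arr C" "Dom C (\<l> a) = \<I> \<otimes> a" "Cod C (\<l> a) = a"
  using nat_trans.component[OF nat_iso.axioms(1)[OF LUnit_iso] assms]
  by (auto simp: hom_def id_ftr_def)

lemma runit_simps [simp]:
  assumes "a \<in> Obj C"
  shows "\<r> a \<in> Arr C" "Dom C (\<r> a) = a \<otimes> \<I>" "Cod C (\<r> a) = a"
  using nat_trans.component[OF nat_iso.axioms(1)[OF RUnit_iso] assms]
  by (auto simp: hom_def id_ftr_def)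

lemma lunit_natural: "\<lbrakk>f \<in> Arr C; Cod C f = b\<rbrakk> \<Longrightarrow> \<l> b \<cdot> (\<one> \<I> \<otimes>\<^sub>m f) = f \<cdot> \<l> (Dom C f)"
  using nat_trans.naturality[OF nat_iso.axioms(1)[OF LUnit_iso], of f "Dom C f" "Cod C f"]
  by (simp add: id_ftr_def hom_def)

lemma runit_natural: "\<lbrakk>f \<in> Arr C; Cod C f = b\<rbrakk> \<Longrightarrow> \<r> b \<cdot> (f \<otimes>\<^sub>m \<one> \<I>) = f \<cdot> \<r> (Dom C f)"
  using nat_trans.naturality[OF nat_iso.axioms(1)[OF RUnit_iso], of f "Dom C f" "Cod C f"]
  by (simp add: id_ftr_def hom_def)

lemma assoc_inv_natural:
  assumes "f \<in> Arr C" "g \<in> Arr C" "h \<in> Arr C" "Cod C f = a" "Cod C g = b" "Cod C h = c"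
  shows "inv_arrow C (\<alpha> a b c) \<cdot> (f \<otimes>\<^sub>m (g \<otimes>\<^sub>m h))
    = ((f \<otimes>\<^sub>m g) \<otimes>\<^sub>m h) \<cdot> inv_arrow C (\<alpha> (Dom C f) (Dom C g) (Dom C h))"
proof -
  have [simp]: "a \<in> Obj C" "b \<in> Obj C" "c \<in> Obj C" using assms by auto
  have "\<alpha> a b c \<cdot> (((f \<otimes>\<^sub>m g) \<otimes>\<^sub>m h) \<cdot> inv_arrow C (\<alpha> (Dom C f) (Dom C g) (Dom C h)))
    = f \<otimes>\<^sub>m (g \<otimes>\<^sub>m h)"
    using assms by (simp add: comp_extend[OF assoc_natural] comp_assoc)
  then show ?thesis using assms by (subst inv_left_eq_iff) auto
qed

lemma tensor_inverse:
  assumes "inverse_arrows C f f'" "inverse_arrows C g g'"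
  shows "inverse_arrows C (f \<otimes>\<^sub>m g) (f' \<otimes>\<^sub>m g')"
  using assms by (auto simp: inverse_arrows_def in_hom_iff tensor_comp)

lemma tensor_iso [simp]: "\<lbrakk>iso_arrow C f; iso_arrow C g\<rbrakk> \<Longrightarrow> iso_arrow C (f \<otimes>\<^sub>m g)"
  unfolding iso_arrow_def using tensor_inverse by blast

lemma unit_tensor_inj:
  assumes "f \<in> Arr C" "g \<in> Arr C" "Dom C f = Dom C g" "Cod C f = Cod C g"
    and "\<one> \<I> \<otimes>\<^sub>m f = \<one> \<I> \<otimes>\<^sub>m g"
  shows "f = g"
proof (rule iso_epi[of "\<l> (Dom C f)"])
  show "f \<cdot> \<l> (Dom C f) = g \<cdot> \<l> (Dom C f)"
    using lunit_natural[OF assms(1) refl] lunit_natural[OF assms(2) refl] assms by simp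
qed (use assms in auto)

text \<open>Kelly's observation that this triangle follows from the pentagon and the middle triangle.
  Tensoring with \<open>I\<close> on the left is faithful, so the equation may be checked after doing so. There it
  results from the pentagon for \<open>I, I, a, b\<close> after composition with two invertible associators, since the
  middle triangles for \<open>a \<otimes> b\<close> and for \<open>a\<close> turn both sides into the unitor \<open>\<r> \<I>\<close>.\<close>

lemma lunit_tensor:
  assumes [simp]: "a \<in> Obj C" "b \<in> Obj C"
  shows "\<l> (a \<otimes> b) \<cdot> \<alpha> \<I> a b = \<l> a \<otimes>\<^sub>m \<one> b"
proof (rule unit_tensor_inj)
  let ?A = "\<alpha> \<I> (\<I> \<otimes> a) b" and ?B = "\<alpha> \<I> \<I> a \<otimes>\<^sub>m \<one> b"
  have "(\<one> \<I> \<otimes>\<^sub>m (\<l> (a \<otimes> b) \<cdot> \<alpha> \<I> a b)) \<cdot> (?A \<cdot> ?B)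
      = (\<one> \<I> \<otimes>\<^sub>m \<l> (a \<otimes> b)) \<cdot> ((\<one> \<I> \<otimes>\<^sub>m \<alpha> \<I> a b) \<cdot> ?A \<cdot> ?B)"
    by (simp add: comp_assoc tensor_comp_extend)
  also have "\<dots> = (\<one> \<I> \<otimes>\<^sub>m \<l> (a \<otimes> b)) \<cdot> (\<alpha> \<I> \<I> (a \<otimes> b) \<cdot> \<alpha> (\<I> \<otimes> \<I>) a b)"
    by (simp add: pentagon)
  also have "\<dots> = (\<r> \<I> \<otimes>\<^sub>m \<one> (a \<otimes> b)) \<cdot> \<alpha> (\<I> \<otimes> \<I>) a b"
    by (simp add: comp_extend[OF triangle])
  also have "\<dots> = \<alpha> \<I> a b \<cdot> ((\<r> \<I> \<otimes>\<^sub>m \<one> a) \<otimes>\<^sub>m \<one> b)"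
    by (simp add: assoc_natural)
  also have "\<dots> = \<alpha> \<I> a b \<cdot> (((\<one> \<I> \<otimes>\<^sub>m \<l> a) \<otimes>\<^sub>m \<one> b) \<cdot> ?B)"
    by (simp add: tensor_comp triangle)
  also have "\<dots> = (\<one> \<I> \<otimes>\<^sub>m (\<l> a \<otimes>\<^sub>m \<one> b)) \<cdot> (?A \<cdot> ?B)"
    by (simp add: comp_extend[OF assoc_natural] comp_assoc)
  finally have *: "((\<one> \<I> \<otimes>\<^sub>m (\<l> (a \<otimes> b) \<cdot> \<alpha> \<I> a b)) \<cdot> ?A) \<cdot> ?B
      = ((\<one> \<I> \<otimes>\<^sub>m (\<l> a \<otimes>\<^sub>m \<one> b)) \<cdot> ?A) \<cdot> ?B"
    by (simp add: comp_assoc)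
  show "\<one> \<I> \<otimes>\<^sub>m (\<l> (a \<otimes> b) \<cdot> \<alpha> \<I> a b) = \<one> \<I> \<otimes>\<^sub>m (\<l> a \<otimes>\<^sub>m \<one> b)"
    by (rule iso_epi[of ?A, OF _ _ _ _ _ iso_epi[of ?B, OF _ _ _ _ _ *]]) simp_all
qed auto

lemma assoc_natural_right:
  assumes [simp]: "a \<in> Obj C" "b \<in> Obj C" "h \<in> Arr C"
  shows "\<alpha> a b (Cod C h) \<cdot> (\<one> (a \<otimes> b) \<otimes>\<^sub>m h) = (\<one> a \<otimes>\<^sub>m (\<one> b \<otimes>\<^sub>m h)) \<cdot> \<alpha> a b (Dom C h)"
  using assoc_natural[of "\<one> a" "\<one> b" h a b "Cod C h"] by simp

lemma assoc_inv_natural_right: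
  assumes [simp]: "a \<in> Obj C" "b \<in> Obj C" "h \<in> Arr C"
  shows "inv_arrow C (\<alpha> a b (Cod C h)) \<cdot> (\<one> a \<otimes>\<^sub>m (\<one> b \<otimes>\<^sub>m h))
    = (\<one> (a \<otimes> b) \<otimes>\<^sub>m h) \<cdot> inv_arrow C (\<alpha> a b (Dom C h))"
  using assoc_inv_natural[of "\<one> a" "\<one> b" h a b "Cod C h"] by simp

lemma whisker_comp:
  assumes "f \<in> Arr C" "g \<in> Arr C" "Dom C g = Cod C f" "a \<in> Obj C"
  shows "\<one> a \<otimes>\<^sub>m (g \<cdot> f) = (\<one> a \<otimes>\<^sub>m g) \<cdot> (\<one> a \<otimes>\<^sub>m f)"
  using assms by (simp add: tensor_comp)

end

section \<open>Precomodules\<close>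

locale monoidal_endofunctor = monoidal_category C
  for C :: "('o, 'm, 'x) moncat_scheme" (structure) +
  fixes G :: "('o, 'm, 'o, 'm) ftr"
  assumes endofunctor: "cat_functor C C G"
begin

lemma G_Obj [simp]: "a \<in> Obj C \<Longrightarrow> G $\<^sub>o a \<in> Obj C"
  by (rule cat_functor.ob_Obj[OF endofunctor])

lemma G_simps [simp]:
  assumes "f \<in> Arr C"
  shows "G $\<^sub>m f \<in> Arr C" "Dom C (G $\<^sub>m f) = G $\<^sub>o (Dom C f)" "Cod C (G $\<^sub>m f) = G $\<^sub>o (Cod C f)"
  using cat_functor.ar_hom[OF endofunctor, of f "Dom C f" "Cod C f"] assms
  by (auto simp: in_hom_iff)

lemma G_ident [simp]: "a \<in> Obj C \<Longrightarrow> G $\<^sub>m (\<one> a) = \<one> (G $\<^sub>o a)"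
  by (rule cat_functor.ar_Ident[OF endofunctor])

lemma G_comp:
  assumes "f \<in> Arr C" "g \<in> Arr C" "Dom C g = Cod C f"
  shows "G $\<^sub>m g \<cdot> G $\<^sub>m f = G $\<^sub>m (g \<cdot> f)"
  using cat_functor.ar_Comp[OF endofunctor, of f "Dom C f" "Cod C f" g "Cod C g"] assms
  by (simp add: in_hom_iff)

lemma G_comp_extend:
  assumes "f \<in> Arr C" "g \<in> Arr C" "Dom C g = Cod C f" "x \<in> Arr C" "Cod C x = G $\<^sub>o (Dom C f)"
  shows "G $\<^sub>m g \<cdot> (G $\<^sub>m f \<cdot> x) = G $\<^sub>m (g \<cdot> f) \<cdot> x"
  by (rule comp_extend[OF G_comp]) (use assms in auto)

text \<open>Extensionality of the family \<open>v\<close> is left out, so that also the family \<open>G2 X\<close> of a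
  bicomonad, whose values outside the objects are arbitrary, makes \<open>G X\<close> a precomodule.\<close>

definition precomodule :: "'o \<Rightarrow> ('o \<Rightarrow> 'm) \<Rightarrow> bool" where
  "precomodule V v \<longleftrightarrow> V \<in> Obj C \<and>
     (\<forall>Y\<in>Obj C. v Y \<in> hom C (V \<otimes> G $\<^sub>o Y) (G $\<^sub>o (V \<otimes> Y))) \<and>
     (\<forall>g\<in>Arr C. v (Cod C g) \<cdot> (\<one> V \<otimes>\<^sub>m G $\<^sub>m g) = G $\<^sub>m (\<one> V \<otimes>\<^sub>m g) \<cdot> v (Dom C g))"

definition precomodule_morphism :: "'o \<Rightarrow> ('o \<Rightarrow> 'm) \<Rightarrow> 'o \<Rightarrow> ('o \<Rightarrow> 'm) \<Rightarrow> 'm \<Rightarrow> bool" where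
  "precomodule_morphism V v W w f \<longleftrightarrow> precomodule V v \<and> precomodule W w \<and> f \<in> hom C V W \<and>
     (\<forall>Y\<in>Obj C. G $\<^sub>m (f \<otimes>\<^sub>m \<one> Y) \<cdot> v Y = w Y \<cdot> (f \<otimes>\<^sub>m \<one> (G $\<^sub>o Y)))"

lemma precomodule_Obj: "precomodule V v \<Longrightarrow> V \<in> Obj C"
  by (simp add: precomodule_def)

lemma precomodule_simps:
  assumes "precomodule V v" "Y \<in> Obj C"
  shows "v Y \<in> Arr C" "Dom C (v Y) = V \<otimes> G $\<^sub>o Y" "Cod C (v Y) = G $\<^sub>o (V \<otimes> Y)"
  using assms by (auto simp: precomodule_def in_hom_iff)

lemma precomodule_natural:
  assumes "precomodule V v" "g \<in> Arr C" "Cod C g = b"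
  shows "v b \<cdot> (\<one> V \<otimes>\<^sub>m G $\<^sub>m g) = G $\<^sub>m (\<one> V \<otimes>\<^sub>m g) \<cdot> v (Dom C g)"
  using assms by (auto simp: precomodule_def)

lemmas precomodule_facts = precomodule_Obj precomodule_simps

lemma precomodule_morphism_precomodules:
  assumes "precomodule_morphism V v W w f"
  shows "precomodule V v" "precomodule W w"
  using assms by (auto simp: precomodule_morphism_def)

lemma precomodule_morphism_simps:
  assumes "precomodule_morphism V v W w f"
  shows "f \<in> Arr C" "Dom C f = V" "Cod C f = W"
  using assms by (auto simp: precomodule_morphism_def in_hom_iff)

lemma precomodule_morphism_coaction:
  assumes "precomodule_morphism V v W w f" "Y \<in> Obj C"
  shows "G $\<^sub>m (f \<otimes>\<^sub>m \<one> Y) \<cdot> v Y = w Y \<cdot> (f \<otimes>\<^sub>m \<one> (G $\<^sub>o Y))"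
  using assms by (auto simp: precomodule_morphism_def)

lemma precomodule_morphism_ident:
  assumes "precomodule V v"
  shows "precomodule_morphism V v V v (\<one> V)"
  using assms precomodule_facts[OF assms]
  by (auto simp: precomodule_morphism_def in_hom_iff)

lemma precomodule_morphism_comp:
  assumes f: "precomodule_morphism U u V v f" and g: "precomodule_morphism V v W w g"
  shows "precomodule_morphism U u W w (g \<cdot> f)"
proof -
  note pre = precomodule_morphism_precomodules[OF f] precomodule_morphism_precomodules(2)[OF g]
  note [simp] = pre[THEN precomodule_Obj] pre[THEN precomodule_simps(1)]
    pre[THEN precomodule_simps(2)] pre[THEN precomodule_simps(3)]
    precomodule_morphism_simps[OF f] precomodule_morphism_simps[OF g]
  have "G $\<^sub>m ((g \<cdot> f) \<otimes>\<^sub>m \<one> Y) \<cdot> u Y = w Y \<cdot> ((g \<cdot> f) \<otimes>\<^sub>m \<one> (G $\<^sub>o Y))"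
    if [simp]: "Y \<in> Obj C" for Y
  proof -
    have "G $\<^sub>m ((g \<cdot> f) \<otimes>\<^sub>m \<one> Y) \<cdot> u Y = G $\<^sub>m (g \<otimes>\<^sub>m \<one> Y) \<cdot> (G $\<^sub>m (f \<otimes>\<^sub>m \<one> Y) \<cdot> u Y)"
      by (simp add: G_comp_extend tensor_comp)
    also have "\<dots> = w Y \<cdot> ((g \<otimes>\<^sub>m \<one> (G $\<^sub>o Y)) \<cdot> (f \<otimes>\<^sub>m \<one> (G $\<^sub>o Y)))"
      by (simp add: precomodule_morphism_coaction[OF f]
          comp_extend[OF precomodule_morphism_coaction[OF g]] comp_assoc)
    finally show ?thesis by (simp add: tensor_comp)
  qed
  then show ?thesis using pre by (simp add: precomodule_morphism_def in_hom_iff)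
qed

text \<open>Compose the compatibility of \<open>f\<close> with its inverse on both sides. This makes the constraints
  of the monoidal category of comodules invertible there.\<close>

lemma precomodule_morphism_inv:
  assumes f: "precomodule_morphism V v W w f" and iso [simp]: "iso_arrow C f"
  shows "precomodule_morphism W w V v (inv_arrow C f)"
proof -
  note pre = precomodule_morphism_precomodules[OF f]
  note [simp] = pre[THEN precomodule_Obj] pre[THEN precomodule_simps(1)]
    pre[THEN precomodule_simps(2)] pre[THEN precomodule_simps(3)]
    precomodule_morphism_simps[OF f]
  let ?g = "inv_arrow C f"
  have "G $\<^sub>m (?g \<otimes>\<^sub>m \<one> Y) \<cdot> w Y = v Y \<cdot> (?g \<otimes>\<^sub>m \<one> (G $\<^sub>o Y))" if [simp]: "Y \<in> Obj C" for Y
  proof -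
    have "G $\<^sub>m (?g \<otimes>\<^sub>m \<one> Y) \<cdot> w Y
        = G $\<^sub>m (?g \<otimes>\<^sub>m \<one> Y) \<cdot> ((w Y \<cdot> (f \<otimes>\<^sub>m \<one> (G $\<^sub>o Y))) \<cdot> (?g \<otimes>\<^sub>m \<one> (G $\<^sub>o Y)))"
      by (simp add: comp_assoc tensor_comp)
    also have "\<dots> = G $\<^sub>m (?g \<otimes>\<^sub>m \<one> Y) \<cdot> ((G $\<^sub>m (f \<otimes>\<^sub>m \<one> Y) \<cdot> v Y) \<cdot> (?g \<otimes>\<^sub>m \<one> (G $\<^sub>o Y)))"
      by (simp only: precomodule_morphism_coaction[OF f that])
    also have "\<dots> = v Y \<cdot> (?g \<otimes>\<^sub>m \<one> (G $\<^sub>o Y))"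
      by (simp add: comp_assoc G_comp_extend tensor_comp)
    finally show ?thesis .
  qed
  then show ?thesis using pre by (simp add: precomodule_morphism_def in_hom_iff)
qed

text \<open>Up to associativity, \<open>V \<otimes> W \<otimes> GY \<rightarrow> V \<otimes> G(W \<otimes> Y) \<rightarrow> G(V \<otimes> W \<otimes> Y)\<close>; the unit
  object carries the canonical isomorphism \<open>I \<otimes> GY \<rightarrow> GY \<rightarrow> G(I \<otimes> Y)\<close>. Both families are restricted to
  the objects because the coaction of a comodule has to be extensional.\<close>

definition tensor_coaction :: "'o \<Rightarrow> ('o \<Rightarrow> 'm) \<Rightarrow> 'o \<Rightarrow> ('o \<Rightarrow> 'm) \<Rightarrow> 'o \<Rightarrow> 'm" where
  "tensor_coaction V v W w = (\<lambda>Y\<in>Obj C.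
     G $\<^sub>m inv_arrow C (\<alpha> V W Y) \<cdot> (v (W \<otimes> Y) \<cdot> ((\<one> V \<otimes>\<^sub>m w Y) \<cdot> \<alpha> V W (G $\<^sub>o Y))))"

definition unit_coaction :: "'o \<Rightarrow> 'm" where
  "unit_coaction = (\<lambda>Y\<in>Obj C. G $\<^sub>m inv_arrow C (\<l> Y) \<cdot> \<l> (G $\<^sub>o Y))"

lemma tensor_coaction_apply:
  "Y \<in> Obj C \<Longrightarrow> tensor_coaction V v W w Y =
     G $\<^sub>m inv_arrow C (\<alpha> V W Y) \<cdot> (v (W \<otimes> Y) \<cdot> ((\<one> V \<otimes>\<^sub>m w Y) \<cdot> \<alpha> V W (G $\<^sub>o Y)))"
  by (simp add: tensor_coaction_def)

lemma precomodule_tensor: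
  assumes v: "precomodule V v" and w: "precomodule W w"
  shows "precomodule (V \<otimes> W) (tensor_coaction V v W w)"
proof -
  note [simp] = precomodule_facts[OF v] precomodule_facts[OF w]
  let ?t = "tensor_coaction V v W w"
  have "?t (Cod C g) \<cdot> (\<one> (V \<otimes> W) \<otimes>\<^sub>m G $\<^sub>m g) = G $\<^sub>m (\<one> (V \<otimes> W) \<otimes>\<^sub>m g) \<cdot> ?t (Dom C g)"
    if [simp]: "g \<in> Arr C" for g
  proof -
    let ?a = "Dom C g" and ?b = "Cod C g"
    let ?i = "\<lambda>Y. G $\<^sub>m inv_arrow C (\<alpha> V W Y)" and ?\<alpha> = "\<alpha> V W (G $\<^sub>o ?a)"
    have "?t ?b \<cdot> (\<one> (V \<otimes> W) \<otimes>\<^sub>m G $\<^sub>m g)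
        = ?i ?b \<cdot> (v (W \<otimes> ?b) \<cdot> ((\<one> V \<otimes>\<^sub>m (w ?b \<cdot> (\<one> W \<otimes>\<^sub>m G $\<^sub>m g))) \<cdot> ?\<alpha>))"
      using assoc_natural_right[of V W "G $\<^sub>m g"]
      by (simp add: tensor_coaction_apply comp_assoc tensor_comp_extend)
    also have "\<dots> = ?i ?b \<cdot> (v (W \<otimes> ?b) \<cdot> ((\<one> V \<otimes>\<^sub>m G $\<^sub>m (\<one> W \<otimes>\<^sub>m g)) \<cdot> ((\<one> V \<otimes>\<^sub>m w ?a) \<cdot> ?\<alpha>)))"
      by (simp add: precomodule_natural[OF w] whisker_comp comp_assoc)
    also have "\<dots> = ?i ?b \<cdot> (G $\<^sub>m (\<one> V \<otimes>\<^sub>m (\<one> W \<otimes>\<^sub>m g)) \<cdot> (v (W \<otimes> ?a) \<cdot> ((\<one> V \<otimes>\<^sub>m w ?a) \<cdot> ?\<alpha>)))"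
      by (simp add: comp_extend[OF precomodule_natural[OF v]] comp_assoc)
    also have "\<dots> = G $\<^sub>m (\<one> (V \<otimes> W) \<otimes>\<^sub>m g) \<cdot> ?t ?a"
      by (simp add: tensor_coaction_apply G_comp_extend assoc_inv_natural_right)
    finally show ?thesis .
  qed
  then show ?thesis
    by (simp add: precomodule_def in_hom_iff) (simp add: tensor_coaction_apply)
qed

lemma precomodule_unit: "precomodule \<I> unit_coaction"
proof -
  have "unit_coaction (Cod C g) \<cdot> (\<one> \<I> \<otimes>\<^sub>m G $\<^sub>m g) = G $\<^sub>m (\<one> \<I> \<otimes>\<^sub>m g) \<cdot> unit_coaction (Dom C g)"
    if [simp]: "g \<in> Arr C" for g
  proof -
    have "inv_arrow C (\<l> (Cod C g)) \<cdot> g = (\<one> \<I> \<otimes>\<^sub>m g) \<cdot> inv_arrow C (\<l> (Dom C g))"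
      by (subst inv_left_eq_iff) (simp_all add: comp_extend[OF lunit_natural] comp_assoc)
    then show ?thesis
      by (simp add: unit_coaction_def comp_assoc lunit_natural G_comp_extend)
  qed
  then show ?thesis
    by (simp add: precomodule_def in_hom_iff) (simp add: unit_coaction_def)
qed

text \<open>Split \<open>f \<otimes> (g \<otimes> 1)\<close> under \<open>G\<close> into a part that acts on \<open>V\<close> and a part that acts on \<open>W \<otimes> Y\<close>. The first
  crosses \<open>v\<close> because \<open>f\<close> is a morphism, the second crosses \<open>v'\<close> by naturality and then \<open>w\<close>
  because \<open>g\<close> is a morphism.\<close>

lemma precomodule_morphism_tensor:
  assumes f: "precomodule_morphism V v V' v' f" and g: "precomodule_morphism W w W' w' g"
  shows "precomodule_morphism (V \<otimes> W) (tensor_coaction V v W w)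
           (V' \<otimes> W') (tensor_coaction V' v' W' w') (f \<otimes>\<^sub>m g)"
proof -
  note pre = precomodule_morphism_precomodules[OF f] precomodule_morphism_precomodules[OF g]
  note [simp] = pre[THEN precomodule_Obj] pre[THEN precomodule_simps(1)]
    pre[THEN precomodule_simps(2)] pre[THEN precomodule_simps(3)]
    precomodule_morphism_simps[OF f] precomodule_morphism_simps[OF g]
  let ?t = "tensor_coaction V v W w" and ?t' = "tensor_coaction V' v' W' w'"
  have "G $\<^sub>m ((f \<otimes>\<^sub>m g) \<otimes>\<^sub>m \<one> Y) \<cdot> ?t Y = ?t' Y \<cdot> ((f \<otimes>\<^sub>m g) \<otimes>\<^sub>m \<one> (G $\<^sub>o Y))"
    if [simp]: "Y \<in> Obj C" for Y
  proof -
    let ?i = "G $\<^sub>m inv_arrow C (\<alpha> V' W' Y)" and ?\<alpha> = "\<alpha> V W (G $\<^sub>o Y)"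
    have "G $\<^sub>m ((f \<otimes>\<^sub>m g) \<otimes>\<^sub>m \<one> Y) \<cdot> ?t Y
        = ?i \<cdot> (G $\<^sub>m (f \<otimes>\<^sub>m (g \<otimes>\<^sub>m \<one> Y)) \<cdot> (v (W \<otimes> Y) \<cdot> ((\<one> V \<otimes>\<^sub>m w Y) \<cdot> ?\<alpha>)))"
      using assoc_inv_natural[of f g "\<one> Y" V' W' Y]
      by (simp add: tensor_coaction_apply G_comp_extend)
    also have "\<dots> = ?i \<cdot> (G $\<^sub>m (\<one> V' \<otimes>\<^sub>m (g \<otimes>\<^sub>m \<one> Y)) \<cdot> (G $\<^sub>m (f \<otimes>\<^sub>m \<one> (W \<otimes> Y)) \<cdot>
          (v (W \<otimes> Y) \<cdot> ((\<one> V \<otimes>\<^sub>m w Y) \<cdot> ?\<alpha>))))"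
      by (simp add: G_comp_extend tensor_comp)
    also have "\<dots> = ?i \<cdot> (v' (W' \<otimes> Y) \<cdot> ((\<one> V' \<otimes>\<^sub>m G $\<^sub>m (g \<otimes>\<^sub>m \<one> Y)) \<cdot>
          ((f \<otimes>\<^sub>m \<one> (G $\<^sub>o (W \<otimes> Y))) \<cdot> ((\<one> V \<otimes>\<^sub>m w Y) \<cdot> ?\<alpha>))))"
      by (simp add: comp_extend[OF precomodule_morphism_coaction[OF f]] comp_assoc
          comp_extend[OF precomodule_natural[OF pre(2)]])
    also have "\<dots> = ?i \<cdot> (v' (W' \<otimes> Y) \<cdot> ((f \<otimes>\<^sub>m (G $\<^sub>m (g \<otimes>\<^sub>m \<one> Y) \<cdot> w Y)) \<cdot> ?\<alpha>))"
      by (simp add: tensor_comp_extend)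
    also have "\<dots> = ?i \<cdot> (v' (W' \<otimes> Y) \<cdot> ((\<one> V' \<otimes>\<^sub>m w' Y) \<cdot> ((f \<otimes>\<^sub>m (g \<otimes>\<^sub>m \<one> (G $\<^sub>o Y))) \<cdot> ?\<alpha>)))"
      by (simp add: tensor_comp_extend precomodule_morphism_coaction[OF g])
    also have "\<dots> = ?t' Y \<cdot> ((f \<otimes>\<^sub>m g) \<otimes>\<^sub>m \<one> (G $\<^sub>o Y))"
      by (simp add: tensor_coaction_apply comp_assoc assoc_natural)
    finally show ?thesis .
  qed
  then show ?thesis
    using pre by (simp add: precomodule_morphism_def in_hom_iff precomodule_tensor)
qed

text \<open>For either bracketing the coaction applies \<open>w\<close>, \<open>v\<close> and \<open>u\<close> in turn (the composite \<open>?m\<close>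
  below) between associators. The pentagon identifies the associators before \<open>?m\<close>, and the
  pentagon of inverses, under \<open>G\<close>, those after it.\<close>

lemma precomodule_morphism_assoc:
  assumes u: "precomodule U u" and v: "precomodule V v" and w: "precomodule W w"
  shows "precomodule_morphism
           ((U \<otimes> V) \<otimes> W) (tensor_coaction (U \<otimes> V) (tensor_coaction U u V v) W w)
           (U \<otimes> (V \<otimes> W)) (tensor_coaction U u (V \<otimes> W) (tensor_coaction V v W w))
           (\<alpha> U V W)"
proof -
  note [simp] = precomodule_facts[OF u] precomodule_facts[OF v] precomodule_facts[OF w]
  let ?l = "tensor_coaction (U \<otimes> V) (tensor_coaction U u V v) W w"
    and ?r = "tensor_coaction U u (V \<otimes> W) (tensor_coaction V v W w)"
  have "G $\<^sub>m (\<alpha> U V W \<otimes>\<^sub>m \<one> Y) \<cdot> ?l Y = ?r Y \<cdot> (\<alpha> U V W \<otimes>\<^sub>m \<one> (G $\<^sub>o Y))"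
    if [simp]: "Y \<in> Obj C" for Y
  proof -
    let ?i = "\<lambda>a b c. inv_arrow C (\<alpha> a b c)"
    let ?u = "u (V \<otimes> (W \<otimes> Y))" and ?v = "v (W \<otimes> Y)" and ?GY = "G $\<^sub>o Y"
    let ?m = "?u \<cdot> ((\<one> U \<otimes>\<^sub>m ?v) \<cdot> (\<one> U \<otimes>\<^sub>m (\<one> V \<otimes>\<^sub>m w Y)))"
    have pent: "(\<alpha> U V W \<otimes>\<^sub>m \<one> Y) \<cdot> (?i (U \<otimes> V) W Y \<cdot> ?i U V (W \<otimes> Y))
        = ?i U (V \<otimes> W) Y \<cdot> (\<one> U \<otimes>\<^sub>m ?i V W Y)"
    proof -
      let ?x = "(\<alpha> U V W \<otimes>\<^sub>m \<one> Y) \<cdot> (?i (U \<otimes> V) W Y \<cdot> ?i U V (W \<otimes> Y))"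
      have "\<alpha> U (V \<otimes> W) Y \<cdot> ?x
          = (\<one> U \<otimes>\<^sub>m ?i V W Y) \<cdot> ((\<one> U \<otimes>\<^sub>m \<alpha> V W Y) \<cdot> (\<alpha> U (V \<otimes> W) Y \<cdot> ?x))"
        by (simp add: tensor_comp_extend)
      also have "\<dots> = (\<one> U \<otimes>\<^sub>m ?i V W Y) \<cdot> ((\<alpha> U V (W \<otimes> Y) \<cdot> \<alpha> (U \<otimes> V) W Y) \<cdot>
          (?i (U \<otimes> V) W Y \<cdot> ?i U V (W \<otimes> Y)))"
        by (simp add: pentagon comp_assoc)
      also have "\<dots> = \<one> U \<otimes>\<^sub>m ?i V W Y"
        by (simp add: comp_assoc)
      finally have "\<one> U \<otimes>\<^sub>m ?i V W Y = \<alpha> U (V \<otimes> W) Y \<cdot> ?x" by (rule sym)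
      then have "?i U (V \<otimes> W) Y \<cdot> (\<one> U \<otimes>\<^sub>m ?i V W Y) = ?x"
        by (subst inv_left_eq_iff) simp_all
      then show ?thesis by (rule sym)
    qed
    have "?l Y = G $\<^sub>m (?i (U \<otimes> V) W Y \<cdot> ?i U V (W \<otimes> Y)) \<cdot>
        (?m \<cdot> (\<alpha> U V (W \<otimes> ?GY) \<cdot> \<alpha> (U \<otimes> V) W ?GY))"
      using assoc_natural_right[of U V "w Y"]
      by (simp add: tensor_coaction_apply comp_assoc G_comp_extend
           comp_extend[OF assoc_natural_right[of U V "w Y", simplified]])
    then have "G $\<^sub>m (\<alpha> U V W \<otimes>\<^sub>m \<one> Y) \<cdot> ?l Y
        = G $\<^sub>m (?i U (V \<otimes> W) Y \<cdot> (\<one> U \<otimes>\<^sub>m ?i V W Y)) \<cdot>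
          (?m \<cdot> (\<alpha> U V (W \<otimes> ?GY) \<cdot> \<alpha> (U \<otimes> V) W ?GY))"
      by (simp add: G_comp_extend pent)
    also have "\<dots> = G $\<^sub>m (?i U (V \<otimes> W) Y \<cdot> (\<one> U \<otimes>\<^sub>m ?i V W Y)) \<cdot>
          (?m \<cdot> ((\<one> U \<otimes>\<^sub>m \<alpha> V W ?GY) \<cdot> (\<alpha> U (V \<otimes> W) ?GY \<cdot> (\<alpha> U V W \<otimes>\<^sub>m \<one> ?GY))))"
      by (simp add: pentagon comp_assoc)
    also have "\<dots> = G $\<^sub>m ?i U (V \<otimes> W) Y \<cdot> (G $\<^sub>m (\<one> U \<otimes>\<^sub>m ?i V W Y) \<cdot>
          (?m \<cdot> ((\<one> U \<otimes>\<^sub>m \<alpha> V W ?GY) \<cdot> (\<alpha> U (V \<otimes> W) ?GY \<cdot> (\<alpha> U V W \<otimes>\<^sub>m \<one> ?GY)))))"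
      by (simp add: G_comp_extend)
    also have "\<dots> = ?r Y \<cdot> (\<alpha> U V W \<otimes>\<^sub>m \<one> ?GY)"
      by (simp add: tensor_coaction_apply comp_assoc whisker_comp
          comp_extend[OF precomodule_natural[OF u]])
    finally show ?thesis .
  qed
  then show ?thesis
    using assms by (simp add: precomodule_morphism_def in_hom_iff precomodule_tensor)
qed

text \<open>Once \<open>v\<close> is moved past the unitor, what remains on either side of it is the triangle
  \<open>lunit_tensor\<close>, under \<open>G\<close> on the one side.\<close>

lemma precomodule_morphism_lunit:
  assumes v: "precomodule V v"
  shows "precomodule_morphism (\<I> \<otimes> V) (tensor_coaction \<I> unit_coaction V v) V v (\<l> V)"
proof -
  note [simp] = precomodule_facts[OF v]
  let ?t = "tensor_coaction \<I> unit_coaction V v"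
  have "G $\<^sub>m (\<l> V \<otimes>\<^sub>m \<one> Y) \<cdot> ?t Y = v Y \<cdot> (\<l> V \<otimes>\<^sub>m \<one> (G $\<^sub>o Y))" if [simp]: "Y \<in> Obj C" for Y
  proof -
    let ?\<alpha> = "\<alpha> \<I> V (G $\<^sub>o Y)"
    \<comment> \<open>The arrows that accumulate under \<open>G\<close> after \<open>v Y\<close>.\<close>
    let ?p = "(\<l> V \<otimes>\<^sub>m \<one> Y) \<cdot> (inv_arrow C (\<alpha> \<I> V Y) \<cdot> inv_arrow C (\<l> (V \<otimes> Y)))"
    have "?p = \<one> (V \<otimes> Y)"
      by (simp add: lunit_tensor[symmetric] comp_assoc)
    have "G $\<^sub>m (\<l> V \<otimes>\<^sub>m \<one> Y) \<cdot> ?t Y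
        = G $\<^sub>m ?p \<cdot> (\<l> (G $\<^sub>o (V \<otimes> Y)) \<cdot> ((\<one> \<I> \<otimes>\<^sub>m v Y) \<cdot> ?\<alpha>))"
      by (simp add: tensor_coaction_apply unit_coaction_def comp_assoc G_comp_extend)
    also have "\<dots> = \<l> (G $\<^sub>o (V \<otimes> Y)) \<cdot> ((\<one> \<I> \<otimes>\<^sub>m v Y) \<cdot> ?\<alpha>)"
      unfolding \<open>?p = \<one> (V \<otimes> Y)\<close> by simp
    also have "\<dots> = v Y \<cdot> (\<l> V \<otimes>\<^sub>m \<one> (G $\<^sub>o Y))"
      by (simp add: comp_extend[OF lunit_natural] comp_assoc lunit_tensor)
    finally show ?thesis .
  qed
  then show ?thesis
    using v by (simp add: precomodule_morphism_def in_hom_iff precomodule_tensor precomodule_unit)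
qed

text \<open>As for the left unitor, but now \<open>v\<close> is moved past the coaction of \<open>I\<close> by naturality, and the
  triangle on either side is the middle one.\<close>

lemma precomodule_morphism_runit:
  assumes v: "precomodule V v"
  shows "precomodule_morphism (V \<otimes> \<I>) (tensor_coaction V v \<I> unit_coaction) V v (\<r> V)"
proof -
  note [simp] = precomodule_facts[OF v]
  let ?t = "tensor_coaction V v \<I> unit_coaction"
  have "G $\<^sub>m (\<r> V \<otimes>\<^sub>m \<one> Y) \<cdot> ?t Y = v Y \<cdot> (\<r> V \<otimes>\<^sub>m \<one> (G $\<^sub>o Y))" if [simp]: "Y \<in> Obj C" for Y
  proof -
    let ?p = "(\<r> V \<otimes>\<^sub>m \<one> Y) \<cdot> (inv_arrow C (\<alpha> V \<I> Y) \<cdot> (\<one> V \<otimes>\<^sub>m inv_arrow C (\<l> Y)))"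
    have "?p = \<one> (V \<otimes> Y)"
      by (simp add: triangle[symmetric] comp_assoc tensor_comp)
    have "G $\<^sub>m (\<r> V \<otimes>\<^sub>m \<one> Y) \<cdot> ?t Y
        = G $\<^sub>m ?p \<cdot> (v Y \<cdot> ((\<one> V \<otimes>\<^sub>m \<l> (G $\<^sub>o Y)) \<cdot> \<alpha> V \<I> (G $\<^sub>o Y)))"
      by (simp add: tensor_coaction_apply unit_coaction_def comp_assoc whisker_comp
          comp_extend[OF precomodule_natural[OF v]] G_comp_extend)
    also have "\<dots> = v Y \<cdot> (\<r> V \<otimes>\<^sub>m \<one> (G $\<^sub>o Y))"
      unfolding \<open>?p = \<one> (V \<otimes> Y)\<close> by (simp add: triangle)
    finally show ?thesis .
  qed
  then show ?thesis
    using v by (simp add: precomodule_morphism_def in_hom_iff precomodule_tensor precomodule_unit)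
qed

end

section \<open>Comodules\<close>

context right_multiplier_bicomonad
begin

sublocale monoidal_endofunctor C G
  by (intro monoidal_endofunctor.intro monoidal_category_axioms monoidal_endofunctor_axioms.intro
      G_functor)

lemma counit_simps [simp]:
  assumes "a \<in> Obj C"
  shows "\<epsilon> a \<in> Arr C" "Dom C (\<epsilon> a) = G $\<^sub>o a" "Cod C (\<epsilon> a) = a"
  using nat_trans.component[OF counit_natural assms] by (auto simp: in_hom_iff id_ftr_def)

lemma counit_naturality: "\<lbrakk>f \<in> Arr C; Cod C f = b\<rbrakk> \<Longrightarrow> \<epsilon> b \<cdot> G $\<^sub>m f = f \<cdot> \<epsilon> (Dom C f)"
  using nat_trans.naturality[OF counit_natural, of f "Dom C f" b]
  by (simp add: in_hom_iff id_ftr_def)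

lemma G2_simps [simp]:
  assumes "X \<in> Obj C" "Y \<in> Obj C"
  shows "G2 X Y \<in> Arr C" "Dom C (G2 X Y) = G $\<^sub>o X \<otimes> G $\<^sub>o Y"
    "Cod C (G2 X Y) = G $\<^sub>o (G $\<^sub>o X \<otimes> Y)"
  using nat_trans.component[OF G2_natural, of "(X, Y)"] assms
  by (auto simp: in_hom_iff prod_cat_def)

lemma G2_naturality:
  assumes "f \<in> Arr C" "g \<in> Arr C"
  shows "G2 (Cod C f) (Cod C g) \<cdot> (G $\<^sub>m f \<otimes>\<^sub>m G $\<^sub>m g) = G $\<^sub>m (G $\<^sub>m f \<otimes>\<^sub>m g) \<cdot> G2 (Dom C f) (Dom C g)"
  using nat_trans.naturality[OF G2_natural, of "(f, g)" "(Dom C f, Dom C g)" "(Cod C f, Cod C g)"]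
    assms by (simp add: hom_def prod_cat_def)

lemma precomodule_G:
  assumes [simp]: "X \<in> Obj C"
  shows "precomodule (G $\<^sub>o X) (G2 X)"
  using G2_naturality[of "\<one> X"] by (simp add: precomodule_def in_hom_iff)

lemma precomodule_morphism_G:
  assumes [simp]: "f \<in> Arr C"
  shows "precomodule_morphism (G $\<^sub>o Dom C f) (G2 (Dom C f)) (G $\<^sub>o Cod C f) (G2 (Cod C f)) (G $\<^sub>m f)"
proof -
  have "G $\<^sub>m (G $\<^sub>m f \<otimes>\<^sub>m \<one> Y) \<cdot> G2 (Dom C f) Y
      = G2 (Cod C f) Y \<cdot> (G $\<^sub>m f \<otimes>\<^sub>m \<one> (G $\<^sub>o Y))" if "Y \<in> Obj C" for Y
    using G2_naturality[of f "\<one> Y"] that by simp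
  then show ?thesis by (simp add: precomodule_morphism_def precomodule_G in_hom_iff)
qed

lemma precomodule_iff_nat_trans:
  assumes [simp]: "V \<in> Obj C"
  shows "nat_trans C C
         \<lparr>ob = \<lambda>Y. V \<otimes> G $\<^sub>o Y, ar = \<lambda>g. \<one> V \<otimes>\<^sub>m G $\<^sub>m g\<rparr>
         \<lparr>ob = \<lambda>Y. G $\<^sub>o (V \<otimes> Y), ar = \<lambda>g. G $\<^sub>m (\<one> V \<otimes>\<^sub>m g)\<rparr> v \<longleftrightarrow> precomodule V v"
    (is "nat_trans C C ?F ?H v \<longleftrightarrow> _")
proof
  assume n: "nat_trans C C ?F ?H v"
  show "precomodule V v"
    using nat_trans.component[OF n] nat_trans.naturality[OF n]
    by (auto simp: precomodule_def in_hom_iff)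
next
  assume v: "precomodule V v"
  have F: "cat_functor C C ?F"
    by unfold_locales (auto simp: in_hom_iff tensor_comp G_comp)
  have H: "cat_functor C C ?H"
    by unfold_locales (auto simp: in_hom_iff tensor_comp G_comp)
  show "nat_trans C C ?F ?H v"
    by (intro nat_trans.intro F H nat_trans_axioms.intro)
      (use v in \<open>auto simp: precomodule_def in_hom_iff\<close>)
qed

text \<open>The left hand side of coassociativity contains the coaction on \<open>V \<otimes> GY\<close> of the tensor product of
  \<open>(V, v)\<close> and \<open>(GY, G2 Y)\<close>, and the right hand side contains the coaction \<open>G2 (V \<otimes> Y)\<close> on the codomain
  of \<open>v Y\<close>.\<close>

lemma coassoc_iff_precomodule_morphism:
  assumes v: "precomodule V v" and [simp]: "Y \<in> Obj C"
  shows "(\<forall>Z\<in>Obj C.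
         G $\<^sub>m (v Y \<otimes>\<^sub>m \<one> Z)
           \<cdot> G $\<^sub>m (inv_arrow C (\<alpha> V (G $\<^sub>o Y) Z))
           \<cdot> v (G $\<^sub>o Y \<otimes> Z)
           \<cdot> (\<one> V \<otimes>\<^sub>m G2 Y Z)
           \<cdot> \<alpha> V (G $\<^sub>o Y) (G $\<^sub>o Z)
         = G2 (V \<otimes> Y) Z \<cdot> (v Y \<otimes>\<^sub>m \<one> (G $\<^sub>o Z))) \<longleftrightarrow>
     precomodule_morphism (V \<otimes> G $\<^sub>o Y) (tensor_coaction V v (G $\<^sub>o Y) (G2 Y))
       (G $\<^sub>o (V \<otimes> Y)) (G2 (V \<otimes> Y)) (v Y)"
proof -
  note [simp] = precomodule_facts[OF v]
  show ?thesis
    using v by (simp add: precomodule_morphism_def precomodule_tensor precomodule_G in_hom_iff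
        tensor_coaction_apply comp_assoc cong: ball_cong)
qed

lemma comodule_iff:
  "comodule C G G2 \<epsilon> V v \<longleftrightarrow> v \<in> extensional (Obj C) \<and> precomodule V v \<and>
     (\<forall>Y\<in>Obj C. precomodule_morphism (V \<otimes> G $\<^sub>o Y) (tensor_coaction V v (G $\<^sub>o Y) (G2 Y))
       (G $\<^sub>o (V \<otimes> Y)) (G2 (V \<otimes> Y)) (v Y)) \<and>
     (\<forall>Y\<in>Obj C. \<epsilon> (V \<otimes> Y) \<cdot> v Y = \<one> V \<otimes>\<^sub>m \<epsilon> Y)"
proof (cases "precomodule V v")
  case True
  show ?thesis
    using True coassoc_iff_precomodule_morphism[OF True]
    by (simp add: comodule_def comodule_axioms_def right_multiplier_bicomonad_axioms
        precomodule_iff_nat_trans precomodule_Obj) blast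
next
  case False
  then show ?thesis
    by (auto simp: comodule_def comodule_axioms_def precomodule_iff_nat_trans)
qed

lemma comodule_precomodule: "comodule C G G2 \<epsilon> V v \<Longrightarrow> precomodule V v"
  by (simp add: comodule_iff)

lemma comodule_morphism_iff:
  "comodule_morphism C G G2 \<epsilon> V v W w f \<longleftrightarrow> comodule C G G2 \<epsilon> V v \<and> comodule C G G2 \<epsilon> W w \<and>
     precomodule_morphism V v W w f"
  by (auto simp: comodule_morphism_def comodule_morphism_axioms_def precomodule_morphism_def
      comodule_precomodule)

text \<open>Every factor of the coaction of \<open>V \<otimes> W\<close> at \<open>Y\<close> is a morphism of precomodules: the associator
  always, \<open>1 \<otimes> w Y\<close> and \<open>v (W \<otimes> Y)\<close> by coassociativity of \<open>w\<close> and \<open>v\<close>, and the inverse associator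
  under \<open>G\<close> by naturality of \<open>G2\<close>. So their composite is one.\<close>

lemma comodule_tensor:
  assumes v: "comodule C G G2 \<epsilon> V v" and w: "comodule C G G2 \<epsilon> W w"
  shows "comodule C G G2 \<epsilon> (V \<otimes> W) (tensor_coaction V v W w)"
proof -
  note pv = comodule_precomodule[OF v] and pw = comodule_precomodule[OF w]
  note [simp] = precomodule_facts[OF pv] precomodule_facts[OF pw]
  let ?t = "tensor_coaction V v W w"
  have "precomodule_morphism ((V \<otimes> W) \<otimes> G $\<^sub>o Y) (tensor_coaction (V \<otimes> W) ?t (G $\<^sub>o Y) (G2 Y))
      (G $\<^sub>o ((V \<otimes> W) \<otimes> Y)) (G2 ((V \<otimes> W) \<otimes> Y)) (?t Y)" if [simp]: "Y \<in> Obj C" for Y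
  proof -
    have w': "precomodule_morphism (W \<otimes> G $\<^sub>o Y) (tensor_coaction W w (G $\<^sub>o Y) (G2 Y))
        (G $\<^sub>o (W \<otimes> Y)) (G2 (W \<otimes> Y)) (w Y)"
      using w by (simp add: comodule_iff)
    have v': "precomodule_morphism (V \<otimes> G $\<^sub>o (W \<otimes> Y))
        (tensor_coaction V v (G $\<^sub>o (W \<otimes> Y)) (G2 (W \<otimes> Y)))
        (G $\<^sub>o (V \<otimes> (W \<otimes> Y))) (G2 (V \<otimes> (W \<otimes> Y))) (v (W \<otimes> Y))"
      using v by (simp add: comodule_iff)
    have i: "precomodule_morphism (G $\<^sub>o (V \<otimes> (W \<otimes> Y))) (G2 (V \<otimes> (W \<otimes> Y)))
        (G $\<^sub>o ((V \<otimes> W) \<otimes> Y)) (G2 ((V \<otimes> W) \<otimes> Y)) (G $\<^sub>m inv_arrow C (\<alpha> V W Y))"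
      using precomodule_morphism_G[of "inv_arrow C (\<alpha> V W Y)"] by simp
    note assoc = precomodule_morphism_assoc[OF pv pw precomodule_G[OF that]]
    note whisker = precomodule_morphism_tensor[OF precomodule_morphism_ident[OF pv] w']
    show ?thesis
      unfolding tensor_coaction_apply[OF that]
      by (rule precomodule_morphism_comp[OF precomodule_morphism_comp[OF
            precomodule_morphism_comp[OF assoc whisker] v'] i])
  qed
  moreover have "\<epsilon> ((V \<otimes> W) \<otimes> Y) \<cdot> ?t Y = \<one> (V \<otimes> W) \<otimes>\<^sub>m \<epsilon> Y" if [simp]: "Y \<in> Obj C" for Y
  proof -
    have cv: "\<epsilon> (V \<otimes> X) \<cdot> v X = \<one> V \<otimes>\<^sub>m \<epsilon> X" if "X \<in> Obj C" for X
      using v that by (simp add: comodule_iff)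
    have cw: "\<epsilon> (W \<otimes> Y) \<cdot> w Y = \<one> W \<otimes>\<^sub>m \<epsilon> Y"
      using w by (simp add: comodule_iff)
    have "\<epsilon> ((V \<otimes> W) \<otimes> Y) \<cdot> ?t Y = inv_arrow C (\<alpha> V W Y) \<cdot>
        ((\<one> V \<otimes>\<^sub>m (\<one> W \<otimes>\<^sub>m \<epsilon> Y)) \<cdot> \<alpha> V W (G $\<^sub>o Y))"
      by (simp add: tensor_coaction_apply comp_extend[OF counit_naturality] comp_assoc
          comp_extend[OF cv] tensor_comp_extend cw)
    also have "\<dots> = \<one> (V \<otimes> W) \<otimes>\<^sub>m \<epsilon> Y"
      using assoc_natural_right[of V W "\<epsilon> Y"] by (subst inv_left_eq_iff) simp_all
    finally show ?thesis .
  qed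
  ultimately show ?thesis
    using precomodule_tensor[OF pv pw] by (simp add: comodule_iff tensor_coaction_def)
qed

text \<open>Here the factors are the left unitor at the precomodule \<open>GY\<close> and a value of \<open>G\<close>.\<close>

lemma comodule_unit: "comodule C G G2 \<epsilon> \<I> unit_coaction"
proof -
  have "precomodule_morphism (\<I> \<otimes> G $\<^sub>o Y) (tensor_coaction \<I> unit_coaction (G $\<^sub>o Y) (G2 Y))
      (G $\<^sub>o (\<I> \<otimes> Y)) (G2 (\<I> \<otimes> Y)) (unit_coaction Y)" if [simp]: "Y \<in> Obj C" for Y
    using precomodule_morphism_comp[OF precomodule_morphism_lunit[OF precomodule_G[OF that]],
        of "G $\<^sub>o (\<I> \<otimes> Y)" "G2 (\<I> \<otimes> Y)" "G $\<^sub>m inv_arrow C (\<l> Y)"]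
      precomodule_morphism_G[of "inv_arrow C (\<l> Y)"]
    by (simp add: unit_coaction_def)
  moreover have "\<epsilon> (\<I> \<otimes> Y) \<cdot> unit_coaction Y = \<one> \<I> \<otimes>\<^sub>m \<epsilon> Y" if [simp]: "Y \<in> Obj C" for Y
  proof -
    have "\<epsilon> (\<I> \<otimes> Y) \<cdot> unit_coaction Y = inv_arrow C (\<l> Y) \<cdot> (\<epsilon> Y \<cdot> \<l> (G $\<^sub>o Y))"
      by (simp add: unit_coaction_def comp_extend[OF counit_naturality] comp_assoc)
    also have "\<dots> = \<one> \<I> \<otimes>\<^sub>m \<epsilon> Y"
      by (subst inv_left_eq_iff) (simp_all add: lunit_natural)
    finally show ?thesis .
  qed
  ultimately show ?thesis
    using precomodule_unit by (simp add: comodule_iff unit_coaction_def)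
qed

section \<open>The monoidal category of comodules\<close>

definition comod_tensor :: "('o, 'm) comod \<Rightarrow> ('o, 'm) comod \<Rightarrow> ('o, 'm) comod" where
  "comod_tensor p q = (fst p \<otimes> fst q, tensor_coaction (fst p) (snd p) (fst q) (snd q))"

definition comodule_moncat :: "(('o, 'm) comod, ('o, 'm) comod_arr) moncat" where
  "comodule_moncat = cat.extend (comodule_category C G G2 \<epsilon>) (moncat.fields
     comod_tensor
     (\<lambda>(p, f, q) (p', f', q'). (comod_tensor p p', f \<otimes>\<^sub>m f', comod_tensor q q'))
     (\<I>, unit_coaction)
     (\<lambda>p q r. (comod_tensor (comod_tensor p q) r, \<alpha> (fst p) (fst q) (fst r),
        comod_tensor p (comod_tensor q r)))
     (\<lambda>p. (comod_tensor (\<I>, unit_coaction) p, \<l> (fst p), p))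
     (\<lambda>p. (comod_tensor p (\<I>, unit_coaction), \<r> (fst p), p)))"

lemma truncate_comodule_moncat: "cat.truncate comodule_moncat = comodule_category C G G2 \<epsilon>"
  by (simp add: comodule_moncat_def cat.defs moncat.defs)

text \<open>Opaque predicates on pairs: they keep their shape when the simplifier splits a comodule
  into its object and its coaction.\<close>

definition is_comodule :: "('o, 'm) comod \<Rightarrow> bool" where
  "is_comodule p \<longleftrightarrow> comodule C G G2 \<epsilon> (fst p) (snd p)"

definition is_morphism :: "('o, 'm) comod \<Rightarrow> ('o, 'm) comod \<Rightarrow> 'm \<Rightarrow> bool" where
  "is_morphism p q f \<longleftrightarrow> precomodule_morphism (fst p) (snd p) (fst q) (snd q) f"

lemma fst_comod_tensor [simp]: "fst (comod_tensor p q) = fst p \<otimes> fst q"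
  by (simp add: comod_tensor_def)

lemma moncat_simps [simp]:
  "p \<in> Obj comodule_moncat \<longleftrightarrow> is_comodule p"
  "(p, f, q) \<in> Arr comodule_moncat \<longleftrightarrow> is_comodule p \<and> is_comodule q \<and> is_morphism p q f"
  "Dom comodule_moncat (p, f, q) = p"
  "Cod comodule_moncat (p, f, q) = q"
  "\<one>\<^bsub>comodule_moncat\<^esub> p = (p, \<one> (fst p), p)"
  "(q', g, r) \<cdot>\<^bsub>comodule_moncat\<^esub> (p, f, q) = (p, g \<cdot> f, r)"
  "p \<otimes>\<^bsub>comodule_moncat\<^esub> q = comod_tensor p q"
  "(p, f, q) \<otimes>\<^sub>m\<^bsub>comodule_moncat\<^esub> (p', f', q') = (comod_tensor p p', f \<otimes>\<^sub>m f', comod_tensor q q')"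
  "\<I>\<^bsub>comodule_moncat\<^esub> = (\<I>, unit_coaction)"
  "\<alpha>\<^bsub>comodule_moncat\<^esub> p q r = (comod_tensor (comod_tensor p q) r, \<alpha> (fst p) (fst q) (fst r),
        comod_tensor p (comod_tensor q r))"
  "\<l>\<^bsub>comodule_moncat\<^esub> p = (comod_tensor (\<I>, unit_coaction) p, \<l> (fst p), p)"
  "\<r>\<^bsub>comodule_moncat\<^esub> p = (comod_tensor p (\<I>, unit_coaction), \<r> (fst p), p)"
  by (auto simp: comodule_moncat_def cat.defs moncat.defs comodule_category_def
      comodule_morphism_iff split_beta is_comodule_def is_morphism_def)

lemma moncat_hom_iff [simp]:
  "(p, f, q) \<in> hom comodule_moncat a b \<longleftrightarrow>
     p = a \<and> q = b \<and> is_comodule a \<and> is_comodule b \<and> is_morphism a b f"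
  by (auto simp: hom_def)

lemma is_comodule_tensor [simp]:
  "\<lbrakk>is_comodule p; is_comodule q\<rbrakk> \<Longrightarrow> is_comodule (comod_tensor p q)"
  by (simp add: is_comodule_def comod_tensor_def comodule_tensor)

lemma is_comodule_unit [simp]: "is_comodule (\<I>, unit_coaction)"
  by (simp add: is_comodule_def comodule_unit)

lemma is_comodule_Obj:
  "is_comodule p \<Longrightarrow> fst p \<in> Obj C"
  "is_comodule (V, v) \<Longrightarrow> V \<in> Obj C"
  using precomodule_Obj[OF comodule_precomodule] by (auto simp: is_comodule_def)

lemma is_morphism_simps:
  assumes "is_morphism p q f"
  shows "f \<in> Arr C" "Dom C f = fst p" "Cod C f = fst q"
  using assms precomodule_morphism_simps by (auto simp: is_morphism_def)

text \<open>The premises \<open>fst p = a\<close> let the rules apply whether \<open>p\<close> is a variable or an explicit pair.\<close>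

lemma is_morphism_rules:
  "\<lbrakk>is_comodule p; fst p = a\<rbrakk> \<Longrightarrow> is_morphism p p (\<one> a)"
  "\<lbrakk>is_morphism p q f; is_morphism q r g\<rbrakk> \<Longrightarrow> is_morphism p r (g \<cdot> f)"
  "\<lbrakk>is_morphism p q f; is_morphism p' q' f'\<rbrakk>
    \<Longrightarrow> is_morphism (comod_tensor p p') (comod_tensor q q') (f \<otimes>\<^sub>m f')"
  "\<lbrakk>is_comodule p; is_comodule q; is_comodule r; fst p = a; fst q = b; fst r = c\<rbrakk>
    \<Longrightarrow> is_morphism (comod_tensor (comod_tensor p q) r) (comod_tensor p (comod_tensor q r)) (\<alpha> a b c)"
  "\<lbrakk>is_comodule p; fst p = a\<rbrakk> \<Longrightarrow> is_morphism (comod_tensor (\<I>, unit_coaction) p) p (\<l> a)"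
  "\<lbrakk>is_comodule p; fst p = a\<rbrakk> \<Longrightarrow> is_morphism (comod_tensor p (\<I>, unit_coaction)) p (\<r> a)"
  by (auto simp: is_morphism_def is_comodule_def comod_tensor_def comodule_precomodule
      precomodule_morphism_ident precomodule_morphism_tensor precomodule_morphism_assoc
      precomodule_morphism_lunit precomodule_morphism_runit intro: precomodule_morphism_comp)

lemma category_comodule_moncat: "category comodule_moncat"
proof
  fix f g h a b c d
  assume "f \<in> hom comodule_moncat a b" "g \<in> hom comodule_moncat b c" "h \<in> hom comodule_moncat c d"
  then show "(h \<cdot>\<^bsub>comodule_moncat\<^esub> g) \<cdot>\<^bsub>comodule_moncat\<^esub> f = h \<cdot>\<^bsub>comodule_moncat\<^esub> (g \<cdot>\<^bsub>comodule_moncat\<^esub> f)"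
    by (cases f; cases g; cases h) (auto simp: is_morphism_simps comp_assoc)
next
  fix f g a b c
  assume "f \<in> hom comodule_moncat a b" "g \<in> hom comodule_moncat b c"
  then show "g \<cdot>\<^bsub>comodule_moncat\<^esub> f \<in> hom comodule_moncat a c"
    by (cases f; cases g) (auto intro: is_morphism_rules)
next
  fix f a b
  assume "f \<in> hom comodule_moncat a b"
  then show "f \<cdot>\<^bsub>comodule_moncat\<^esub> \<one>\<^bsub>comodule_moncat\<^esub> a = f"
    "\<one>\<^bsub>comodule_moncat\<^esub> b \<cdot>\<^bsub>comodule_moncat\<^esub> f = f"
    by (cases f; auto simp: is_morphism_simps)+
next
  fix a
  assume "a \<in> Obj comodule_moncat"
  then show "\<one>\<^bsub>comodule_moncat\<^esub> a \<in> hom comodule_moncat a a"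
    by (simp add: is_morphism_rules)
qed auto

lemma iso_arrow_comodule_moncat:
  assumes "is_comodule p" "is_comodule q" and f: "is_morphism p q f" and [simp]: "iso_arrow C f"
  shows "iso_arrow comodule_moncat (p, f, q)"
proof -
  have "inverse_arrows comodule_moncat (p, f, q) (q, inv_arrow C f, p)"
    using assms precomodule_morphism_inv[OF f[unfolded is_morphism_def]]
    by (simp add: inverse_arrows_def is_morphism_simps[OF f] is_morphism_def)
  then show ?thesis unfolding iso_arrow_def by blast
qed

lemma tensor_functor_comodule_moncat:
  "cat_functor (prod_cat comodule_moncat comodule_moncat) comodule_moncat
     \<lparr>ob = \<lambda>(a, b). a \<otimes>\<^bsub>comodule_moncat\<^esub> b, ar = \<lambda>(f, g). f \<otimes>\<^sub>m\<^bsub>comodule_moncat\<^esub> g\<rparr>"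
  by (intro cat_functor.intro cat_functor_axioms.intro category_prod category_comodule_moncat)
    (auto simp: is_comodule_Obj is_morphism_simps tensor_comp
      intro: is_morphism_rules)

text \<open>The underlying arrow determines an arrow of comodules with given source and target, so each
  equation required here is the corresponding one in \<open>C\<close>; the rest is that all arrows are morphisms.\<close>

lemma monoidal_comodule_moncat: "monoidal_category comodule_moncat"
proof -
  let ?M = comodule_moncat
  note cat = category_comodule_moncat and tensor = tensor_functor_comodule_moncat
  have "nat_iso (prod_cat (prod_cat ?M ?M) ?M) ?M
         \<lparr>ob = \<lambda>((a, b), c). (a \<otimes>\<^bsub>?M\<^esub> b) \<otimes>\<^bsub>?M\<^esub> c, ar = \<lambda>((f, g), h). (f \<otimes>\<^sub>m\<^bsub>?M\<^esub> g) \<otimes>\<^sub>m\<^bsub>?M\<^esub> h\<rparr>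
         \<lparr>ob = \<lambda>((a, b), c). a \<otimes>\<^bsub>?M\<^esub> (b \<otimes>\<^bsub>?M\<^esub> c), ar = \<lambda>((f, g), h). f \<otimes>\<^sub>m\<^bsub>?M\<^esub> (g \<otimes>\<^sub>m\<^bsub>?M\<^esub> h)\<rparr>
         (\<lambda>((a, b), c). \<alpha>\<^bsub>?M\<^esub> a b c)"
    by (intro nat_iso.intro nat_iso_axioms.intro nat_trans.intro nat_trans_axioms.intro
        cat_functor.intro cat_functor_axioms.intro category_prod cat)
      (auto simp: is_comodule_Obj is_morphism_simps tensor_comp assoc_natural is_morphism_rules(3,4)
        iso_arrow_comodule_moncat)
  moreover have "nat_iso ?M ?M \<lparr>ob = \<lambda>a. \<I>\<^bsub>?M\<^esub> \<otimes>\<^bsub>?M\<^esub> a, ar = \<lambda>f. \<one>\<^bsub>?M\<^esub> \<I>\<^bsub>?M\<^esub> \<otimes>\<^sub>m\<^bsub>?M\<^esub> f\<rparr> id_ftr (\<lambda>a. \<l>\<^bsub>?M\<^esub> a)"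
    by (intro nat_iso.intro nat_iso_axioms.intro nat_trans.intro nat_trans_axioms.intro
        cat_functor.intro cat_functor_axioms.intro cat)
      (auto simp: is_comodule_Obj is_morphism_simps tensor_comp lunit_natural id_ftr_def
        is_morphism_rules(1,3) intro: is_morphism_rules iso_arrow_comodule_moncat)
  moreover have "nat_iso ?M ?M \<lparr>ob = \<lambda>a. a \<otimes>\<^bsub>?M\<^esub> \<I>\<^bsub>?M\<^esub>, ar = \<lambda>f. f \<otimes>\<^sub>m\<^bsub>?M\<^esub> \<one>\<^bsub>?M\<^esub> \<I>\<^bsub>?M\<^esub>\<rparr> id_ftr (\<lambda>a. \<r>\<^bsub>?M\<^esub> a)"
    by (intro nat_iso.intro nat_iso_axioms.intro nat_trans.intro nat_trans_axioms.intro
        cat_functor.intro cat_functor_axioms.intro cat)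
      (auto simp: is_comodule_Obj is_morphism_simps tensor_comp runit_natural id_ftr_def
        is_morphism_rules(1,3) intro: is_morphism_rules iso_arrow_comodule_moncat)
  ultimately show ?thesis
    by (intro monoidal_category.intro monoidal_category_axioms.intro cat tensor)
      (simp_all add: is_comodule_Obj pentagon triangle)
qed

lemma forgetful_strict_monoidal: "strict_monoidal_functor comodule_moncat C forgetful"
proof -
  have "cat_functor comodule_moncat C forgetful"
    by (intro cat_functor.intro cat_functor_axioms.intro category_comodule_moncat category_axioms)
      (auto simp: forgetful_def split_beta in_hom_iff is_comodule_Obj is_morphism_simps)
  then show ?thesis
    by (intro strict_monoidal_functor.intro strict_monoidal_functor_axioms.intro
        monoidal_comodule_moncat monoidal_category_axioms)
      (auto simp: forgetful_def split_beta)
qed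

end

theorem theorem2p9:
  fixes C :: "('o, 'm) moncat"
    and G :: "('o, 'm, 'o, 'm) ftr"
    and G2 :: "'o \<Rightarrow> 'o \<Rightarrow> 'm"
    and \<epsilon> :: "'o \<Rightarrow> 'm"
  assumes "right_multiplier_bicomonad C G G2 \<epsilon>"
  shows "\<exists>M :: (('o, 'm) comod, ('o, 'm) comod_arr) moncat.
           monoidal_category M \<and>
           cat.truncate M = comodule_category C G G2 \<epsilon> \<and>
           strict_monoidal_functor M C forgetful"
proof -
  interpret right_multiplier_bicomonad C G G2 \<epsilon> by (rule assms)
  show ?thesis
    using monoidal_comodule_moncat truncate_comodule_moncat forgetful_strict_monoidal by blast
qed

end
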